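(* Let $f\in L^1(\mathbb{R}^2)$. For $\theta\in[0,2\pi)$, identified with the unit vector $(\cos\theta,\sin\theta)$, and $\Im z>0$ set $$F_\theta(z)=\int_0^\infty e^{2i\pi r z}\,\hat f(r\theta)\,r\,dr .$$ Then $$4\pi\int_0^{2\pi}\|F_\theta\|_B^2\,d\theta=\|f\|_{L^2(\mathbb{R}^2)}^2 ,$$ as an equality in $[0,+\infty]$, where $\displaystyle\|F_\theta\|_B^2=\int_0^\infty\int_{-\infty}^{+\infty}|F_\theta(t+iy)|^2\,dt\,dy$.
   Context: The Fourier transform is $\hat f(\xi)=\int_{\mathbb{R}^2}f(x)e^{-2i\pi x\cdot\xi}\,dx$. The notation $\hat f(r\theta)$ means $\hat f(r\cos\theta,r\sin\theta)$. $\|\cdot\|_B$ is the (unweighted) Bergman norm on the upper half plane. *)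

theory Defs
  imports "HOL-Analysis.Analysis"
begin

definition fourier_transform :: "(real \<times> real \<Rightarrow> complex) \<Rightarrow> real \<times> real \<Rightarrow> complex" where
  "fourier_transform f \<xi> =
     (LINT x|lebesgue. f x * exp (- 2 * \<i> * complex_of_real pi * complex_of_real (x \<bullet> \<xi>)))"

definition angular_transform :: "(real \<times> real \<Rightarrow> complex) \<Rightarrow> real \<Rightarrow> complex \<Rightarrow> complex" where
  "angular_transform f \<theta> z =
     (LINT r:{0<..}|lebesgue. exp (2 * \<i> * complex_of_real pi * complex_of_real r * z)
        * fourier_transform f (r * cos \<theta>, r * sin \<theta>) * complex_of_real r)"

text \<open>Squared norms take values in \<^typ>\<open>ennreal\<close>, so that they may be infinite.\<close>

definition bergman_norm_sq :: "(complex \<Rightarrow> complex) \<Rightarrow> ennreal" where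
  "bergman_norm_sq F =
     (\<integral>\<^sup>+y\<in>{0<..}. (\<integral>\<^sup>+t. ennreal ((cmod (F (Complex t y)))\<^sup>2) \<partial>lebesgue) \<partial>lebesgue)"

definition L2_norm_sq :: "(real \<times> real \<Rightarrow> complex) \<Rightarrow> ennreal" where
  "L2_norm_sq f = (\<integral>\<^sup>+x. ennreal ((cmod (f x))\<^sup>2) \<partial>lebesgue)"

end

theory Submission
  imports Defs "HOL-Probability.Probability"
begin

text \<open>
  For fixed \<open>y > 0\<close>, the function \<open>t \<mapsto> F\<^sub>\<theta>(t + iy)\<close> is, up to \<open>t \<mapsto> -t\<close>, the one-dimensional Fourier
  transform of \<open>r \<mapsto> 1\<^bsub>r>0\<^esub> e\<^bsup>-2\<pi>ry\<^esup> f^(r\<theta>) r\<close>. Plancherel on the line, Tonelli and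
  \<open>\<integral>\<^sub>0\<^sup>\<infinity> e\<^bsup>-4\<pi>ry\<^esup> dy = 1/(4\<pi>r)\<close> turn the squared Bergman norm into \<open>1/(4\<pi>) \<integral> |f^(r\<theta>)|\<^sup>2 r dr\<close>;
  polar coordinates and Plancherel in the plane conclude.

  Plancherel is needed in \<open>[0,\<infinity>]\<close> for arbitrary integrable functions. On the line, let \<open>G\<close> be the
  centred Gaussian density of standard deviation \<open>s\<close>. By Fubini, the squared \<open>L\<^sup>2\<close> norms of \<open>f * G\<close>
  and of \<open>f^(\<xi>) exp(-2\<pi>\<^sup>2s\<^sup>2\<xi>\<^sup>2)\<close> are the same double integral of \<open>f(x) cnj(f(x'))\<close> against the
  Gaussian of variance \<open>2s\<^sup>2\<close> in \<open>x - x'\<close>. As \<open>s \<rightarrow> 0\<close>, Fatou's lemma gives both inequalities, because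
  \<open>f * G\<close> converges to \<open>f\<close> almost everywhere along a subsequence and has \<open>L\<^sup>2\<close> norm at most that of
  \<open>f\<close>. In the plane, apply the result to one variable at a time.
\<close>

subsection \<open>Continuity of translation in L1\<close>

text \<open>The L1 modulus of translation. With values in \<open>ennreal\<close>, the triangle
  estimates hold for all measurable functions, integrable or not.\<close>

definition shift_dist :: "(real \<Rightarrow> 'a::real_normed_vector) \<Rightarrow> real \<Rightarrow> ennreal" where
  "shift_dist f h = (\<integral>\<^sup>+x. ennreal (norm (f (x + h) - f x)) \<partial>lborel)"

lemma nn_integral_shift:
  fixes g :: "real \<Rightarrow> ennreal"
  assumes [measurable]: "g \<in> borel_measurable borel"
  shows "(\<integral>\<^sup>+x. g (x + h) \<partial>lborel) = (\<integral>\<^sup>+x. g x \<partial>lborel)"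
  using nn_integral_real_affine[of g 1 h] by (simp add: add.commute)

lemma nn_integral_minus:
  fixes g :: "real \<Rightarrow> ennreal"
  assumes [measurable]: "g \<in> borel_measurable borel"
  shows "(\<integral>\<^sup>+x. g (- x) \<partial>lborel) = (\<integral>\<^sup>+x. g x \<partial>lborel)"
  using nn_integral_real_affine[of g "-1" 0] by simp

lemma shift_dist_add:
  fixes f g :: "real \<Rightarrow> 'a::{real_normed_vector, second_countable_topology}"
  assumes [measurable]: "f \<in> borel_measurable borel" "g \<in> borel_measurable borel"
  shows "shift_dist (\<lambda>x. f x + g x) h \<le> shift_dist f h + shift_dist g h"
proof -
  have "shift_dist (\<lambda>x. f x + g x) h
      \<le> (\<integral>\<^sup>+x. ennreal (norm (f (x + h) - f x)) + ennreal (norm (g (x + h) - g x)) \<partial>lborel)"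
    unfolding shift_dist_def
    by (intro nn_integral_mono)
       (auto simp: ennreal_plus[symmetric] add_diff_add simp del: ennreal_plus intro!: ennreal_leI norm_triangle_ineq)
  also have "\<dots> = shift_dist f h + shift_dist g h"
    unfolding shift_dist_def by (rule nn_integral_add) auto
  finally show ?thesis .
qed

lemma shift_dist_bound:
  fixes f :: "real \<Rightarrow> 'a::{real_normed_vector, second_countable_topology}"
  assumes [measurable]: "f \<in> borel_measurable borel"
  shows "shift_dist f h \<le> 2 * (\<integral>\<^sup>+x. ennreal (norm (f x)) \<partial>lborel)"
proof -
  have "shift_dist f h \<le> (\<integral>\<^sup>+x. ennreal (norm (f (x + h))) + ennreal (norm (f x)) \<partial>lborel)"
    unfolding shift_dist_def
    by (intro nn_integral_mono)
       (auto simp: ennreal_plus[symmetric] simp del: ennreal_plus intro!: ennreal_leI norm_triangle_ineq4)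
  also have "\<dots> = (\<integral>\<^sup>+x. ennreal (norm (f (x + h))) \<partial>lborel) + (\<integral>\<^sup>+x. ennreal (norm (f x)) \<partial>lborel)"
    by (rule nn_integral_add) auto
  also have "\<dots> = 2 * (\<integral>\<^sup>+x. ennreal (norm (f x)) \<partial>lborel)"
    using nn_integral_shift[of "\<lambda>x. ennreal (norm (f x))" h] by (simp add: mult_2)
  finally show ?thesis .
qed

lemma tendsto_zero_ennrealI:
  fixes X :: "nat \<Rightarrow> ennreal"
  assumes "\<And>e. 0 < e \<Longrightarrow> \<forall>\<^sub>F n in sequentially. X n \<le> ennreal e"
  shows "X \<longlonglongrightarrow> 0"
proof (rule order_tendstoI)
  fix a :: ennreal assume "0 < a"
  then obtain b where b: "0 < b" "b < a" using dense by blast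
  then have "b < top" using order.strict_trans2[OF b(2)] by auto
  then obtain e where e: "b = ennreal e" "0 \<le> e" by (cases b) auto
  then have "0 < e" using b by (auto simp: ennreal_less_zero_iff)
  from assms[OF this] show "\<forall>\<^sub>F n in sequentially. X n < a"
    by eventually_elim (use b e in auto)
qed auto

text \<open>By \<open>shift_dist_add\<close> and \<open>shift_dist_bound\<close>, passing from
  \<open>g\<close> to \<open>f\<close> raises the modulus by at most twice their L1 distance,
  uniformly in the shift. Continuity of translation is therefore inherited by L1 limits.\<close>

lemma shift_dist_tendsto_zero_closed:
  fixes f :: "real \<Rightarrow> 'a::{real_normed_vector, second_countable_topology}"
  assumes [measurable]: "f \<in> borel_measurable borel"
    and approx: "\<And>e::real. 0 < e \<Longrightarrow> \<exists>g\<in>borel_measurable borel.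
      (\<lambda>n. shift_dist g (h n)) \<longlonglongrightarrow> 0 \<and> (\<integral>\<^sup>+x. ennreal (norm (f x - g x)) \<partial>lborel) \<le> ennreal e"
  shows "(\<lambda>n. shift_dist f (h n)) \<longlonglongrightarrow> 0"
proof (rule tendsto_zero_ennrealI)
  fix e :: real assume "0 < e"
  \<comment> \<open>A quarter of \<open>e\<close>, because \<open>shift_dist_bound\<close> doubles
    the error and the other half of \<open>e\<close> is reserved for the modulus of
    \<open>g\<close>.\<close>
  then obtain g where [measurable]: "g \<in> borel_measurable borel"
    and g: "(\<lambda>n. shift_dist g (h n)) \<longlonglongrightarrow> 0"
    and d: "(\<integral>\<^sup>+x. ennreal (norm (f x - g x)) \<partial>lborel) \<le> ennreal (e / 4)"
    using approx[of "e / 4"] by auto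
  have *: "shift_dist f t \<le> shift_dist g t + ennreal (e / 2)" for t
  proof -
    have "shift_dist f t \<le> shift_dist g t + shift_dist (\<lambda>x. f x - g x) t"
      using shift_dist_add[of g "\<lambda>x. f x - g x" t] by simp
    also have "shift_dist (\<lambda>x. f x - g x) t \<le> 2 * (\<integral>\<^sup>+x. ennreal (norm (f x - g x)) \<partial>lborel)"
      by (rule shift_dist_bound) simp
    also have "\<dots> \<le> 2 * ennreal (e / 4)"
      by (intro mult_left_mono d) simp
    also have "\<dots> = ennreal (e / 2)"
      using \<open>0 < e\<close> by (subst ennreal_numeral[symmetric], subst ennreal_mult[symmetric]) auto
    finally show ?thesis by simp
  qed
  have "\<forall>\<^sub>F n in sequentially. shift_dist g (h n) < ennreal (e / 2)"
    using g \<open>0 < e\<close> by (intro order_tendstoD(2)) auto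
  then show "\<forall>\<^sub>F n in sequentially. shift_dist f (h n) \<le> ennreal e"
  proof eventually_elim
    case (elim n)
    have "shift_dist f (h n) \<le> ennreal (e / 2) + ennreal (e / 2)"
      using *[of "h n"] elim by (meson add_right_mono less_imp_le order_trans)
    also have "\<dots> = ennreal e"
      using \<open>0 < e\<close> by (subst ennreal_plus[symmetric]) auto
    finally show ?case .
  qed
qed

text \<open>Openness controls points inside: a point of \<open>U\<close> stays in \<open>U\<close>
  under small shifts, so dominated convergence applies there. Points that enter \<open>U\<close> are
  translated back and become points that leave \<open>U\<close> under the opposite shift.\<close>

lemma shift_dist_indicator_open:
  fixes c :: "'a::{real_normed_vector, second_countable_topology}"
  assumes U: "open U" "emeasure lborel U < \<infinity>" and h: "h \<longlonglongrightarrow> 0"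
  shows "(\<lambda>n. shift_dist (\<lambda>x. indicator U x *\<^sub>R c) (h n)) \<longlonglongrightarrow> 0"
proof -
  have [measurable]: "U \<in> sets borel" using U by auto
  \<comment> \<open>\<open>D t\<close> is the measure of the set of points of \<open>U\<close> that
    the shift by \<open>t\<close> moves out of \<open>U\<close>.\<close>
  define D where "D t = (\<integral>\<^sup>+x. ennreal (norm (indicator U x - indicator U x * indicator U (x + t) :: real)) \<partial>lborel)" for t
  have D: "(\<lambda>n. D (k n)) \<longlonglongrightarrow> 0" if k: "k \<longlonglongrightarrow> 0" for k
    unfolding D_def
  proof (rule nn_integral_dominated_convergence_norm[where w="indicator U"])
    show "AE x in lborel. (\<lambda>i. indicator U x * indicator U (x + k i) :: real) \<longlonglongrightarrow> indicator U x"
    proof (rule AE_I2)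
      fix x :: real
      show "(\<lambda>i. indicator U x * indicator U (x + k i) :: real) \<longlonglongrightarrow> indicator U x"
      proof (cases "x \<in> U")
        case True
        have "(\<lambda>i. x + k i) \<longlonglongrightarrow> x + 0" by (intro tendsto_intros k)
        then have "\<forall>\<^sub>F i in sequentially. x + k i \<in> U"
          using topological_tendstoD[of _ "x+0"] U True by force
        then show ?thesis using True
          by (intro tendsto_eventually) (auto elim!: eventually_mono)
      qed simp
    qed
    show "(\<integral>\<^sup>+x. ennreal (indicator U x) \<partial>lborel) < \<infinity>"
      using U by (simp add: ennreal_indicator)
  qed (auto simp: indicator_def)
  have "shift_dist (\<lambda>x. indicator U x *\<^sub>R c) t = ennreal (norm c) * (D t + D (- t))" for t
  proof -
    \<comment> \<open>Rewriting \<open>x\<close> as \<open>(x + t) + - t\<close> exhibits the second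
      summand as the integrand of \<open>D (- t)\<close> evaluated at \<open>x + t\<close>.\<close>
    have "shift_dist (\<lambda>x. indicator U x *\<^sub>R c) t = (\<integral>\<^sup>+x. ennreal (norm c) *
       (ennreal (norm (indicator U x - indicator U x * indicator U (x + t) :: real)) +
        ennreal (norm (indicator U (x + t) - indicator U (x + t) * indicator U ((x + t) + - t) :: real))) \<partial>lborel)"
      unfolding shift_dist_def by (intro nn_integral_cong) (auto simp: indicator_def)
    also have "\<dots> = ennreal (norm c) * (D t + (\<integral>\<^sup>+x. ennreal (norm (indicator U (x + t) - indicator U (x + t) * indicator U ((x + t) + - t) :: real)) \<partial>lborel))"
      unfolding D_def by (subst nn_integral_cmult, simp, subst nn_integral_add) simp_all
    also have "(\<integral>\<^sup>+x. ennreal (norm (indicator U (x + t) - indicator U (x + t) * indicator U ((x + t) + - t) :: real)) \<partial>lborel) = D (- t)"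
      unfolding D_def
      by (rule nn_integral_shift[of "\<lambda>x. ennreal (norm (indicator U x - indicator U x * indicator U (x + - t) :: real))" t]) simp
    finally show ?thesis .
  qed
  moreover have "(\<lambda>n. ennreal (norm c) * (D (h n) + D (- h n))) \<longlonglongrightarrow> ennreal (norm c) * (0 + 0)"
    using h tendsto_minus[OF h] by (intro ennreal_tendsto_cmult tendsto_add D) auto
  ultimately show ?thesis by simp
qed

text \<open>Induction over integrable functions: outer regularity approximates a Borel set of finite
  measure by open sets, sums follow from subadditivity, and limits from closedness under L1
  convergence.\<close>

lemma shift_dist_tendsto_zero:
  fixes f :: "real \<Rightarrow> 'a::{banach, second_countable_topology}"
  assumes f: "integrable lborel f" and h: "h \<longlonglongrightarrow> 0"
  shows "(\<lambda>n. shift_dist f (h n)) \<longlonglongrightarrow> 0"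
  using f
proof induction
  case (base A c)
  then have [measurable]: "A \<in> sets borel" by simp
  show ?case
  proof (rule shift_dist_tendsto_zero_closed)
    fix e :: real assume e: "0 < e"
    \<comment> \<open>The denominator \<open>norm c + 1\<close> stays positive when
      \<open>c = 0\<close>.\<close>
    obtain U where U: "open U" "A \<subseteq> U" "emeasure lborel (U - A) < ennreal (e / (norm c + 1))"
      using outer_regular_lborel[of A "e / (norm c + 1)"] e
      by (auto simp: add_nonneg_pos)
    then have [measurable]: "U \<in> sets borel" by auto
    have "emeasure lborel U = emeasure lborel A + emeasure lborel (U - A)"
      using U by (subst plus_emeasure) (auto intro!: arg_cong[where f="emeasure lborel"])
    then have fin: "emeasure lborel U < \<infinity>" using base U order.strict_trans by fastforce
    have "(\<integral>\<^sup>+x. ennreal (norm (indicator A x *\<^sub>R c - indicator U x *\<^sub>R c)) \<partial>lborel)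
       = (\<integral>\<^sup>+x. ennreal (norm c) * indicator (U - A) x \<partial>lborel)"
      using U by (intro nn_integral_cong) (auto simp: indicator_def)
    also have "\<dots> = ennreal (norm c) * emeasure lborel (U - A)"
      by (simp add: nn_integral_cmult)
    also have "\<dots> \<le> ennreal (norm c) * ennreal (e / (norm c + 1))"
      using U by (intro mult_left_mono) auto
    also have "\<dots> = ennreal (norm c * (e / (norm c + 1)))"
      using e by (subst ennreal_mult) auto
    also have "\<dots> \<le> ennreal e"
    proof (rule ennreal_leI)
      have "norm c * (e / (norm c + 1)) \<le> (norm c + 1) * (e / (norm c + 1))"
        using e by (intro mult_right_mono) auto
      also have "\<dots> = e"
        using norm_ge_zero[of c] by (simp add: add_nonneg_eq_0_iff)
      finally show "norm c * (e / (norm c + 1)) \<le> e" .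
    qed
    finally show "\<exists>g\<in>borel_measurable borel. (\<lambda>n. shift_dist g (h n)) \<longlonglongrightarrow> 0 \<and>
        (\<integral>\<^sup>+x. ennreal (norm (indicator A x *\<^sub>R c - g x)) \<partial>lborel) \<le> ennreal e"
      using shift_dist_indicator_open[OF U(1) fin h, of c]
      by (intro bexI[of _ "\<lambda>x. indicator U x *\<^sub>R c"] conjI) auto
  qed simp
next
  case (add f g)
  have [measurable]: "f \<in> borel_measurable borel" "g \<in> borel_measurable borel"
    using add borel_measurable_integrable by fastforce+
  have "(\<lambda>n. shift_dist f (h n) + shift_dist g (h n)) \<longlonglongrightarrow> 0 + 0"
    using add by (intro tendsto_add) auto
  then show ?case
    by (intro tendsto_sandwich[OF _ _ tendsto_const, of 0 "\<lambda>n. shift_dist (\<lambda>x. f x + g x) (h n)" _ "\<lambda>n. shift_dist f (h n) + shift_dist g (h n)"])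
       (auto intro!: shift_dist_add always_eventually)
next
  case (lim f s)
  have [measurable]: "f \<in> borel_measurable borel" "s i \<in> borel_measurable borel" for i
    using lim borel_measurable_integrable by fastforce+
  \<comment> \<open>The approximants satisfy \<open>norm (s i x) \<le> 2 * norm (f x)\<close>, so
    their pointwise convergence is also convergence in L1.\<close>
  have *: "(\<lambda>i. \<integral>\<^sup>+x. ennreal (norm (f x - s i x)) \<partial>lborel) \<longlonglongrightarrow> 0"
  proof (rule nn_integral_dominated_convergence_norm[where w="\<lambda>x. 2 * norm (f x)"])
    show "(\<integral>\<^sup>+x. ennreal (2 * norm (f x)) \<partial>lborel) < \<infinity>"
      using lim.hyps(4) by (simp add: integrable_iff_bounded ennreal_mult nn_integral_cmult ennreal_mult_less_top)
  qed (use lim in auto)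
  show ?case
  proof (rule shift_dist_tendsto_zero_closed)
    fix e :: real assume "0 < e"
    then obtain i where "(\<integral>\<^sup>+x. ennreal (norm (f x - s i x)) \<partial>lborel) < ennreal e"
      using order_tendstoD(2)[OF *, of "ennreal e"] by (auto dest!: eventually_happens'[rotated])
    then show "\<exists>g\<in>borel_measurable borel. (\<lambda>n. shift_dist g (h n)) \<longlonglongrightarrow> 0 \<and>
        (\<integral>\<^sup>+x. ennreal (norm (f x - g x)) \<partial>lborel) \<le> ennreal e"
      using lim.IH by (intro bexI[of _ "s i"]) auto
  qed simp
qed

subsection \<open>Gaussian approximate identity\<close>

definition gauss_conv :: "real \<Rightarrow> (real \<Rightarrow> complex) \<Rightarrow> real \<Rightarrow> complex" where
  "gauss_conv s f y = (LINT x|lborel. complex_of_real (normal_density 0 s (y - x)) * f x)"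

lemma borel_measurable_gauss_conv [measurable]:
  assumes [measurable]: "f \<in> borel_measurable borel"
  shows "gauss_conv s f \<in> borel_measurable borel"
  unfolding gauss_conv_def by measurable

lemma normal_density_bound:
  assumes "0 < s"
  shows "normal_density 0 s x \<le> 1 / sqrt (2 * pi * s\<^sup>2)"
  unfolding normal_density_def using assms
  by (intro mult_left_le) (auto intro!: divide_nonneg_nonneg)

lemma nn_integral_normal_density:
  assumes "0 < s"
  shows "(\<integral>\<^sup>+x. ennreal (normal_density 0 s x) \<partial>lborel) = 1"
  using assms integral_normal_density[of s 0] integrable_normal_density[of s 0]
  by (subst nn_integral_eq_integral) auto

lemma integrable_gauss_conv_kernel:
  assumes s: "0 < s" and f: "integrable lborel f"
  shows "integrable lborel (\<lambda>x. complex_of_real (normal_density 0 s (y - x)) * f x)"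
proof -
  define B where "B = 1 / sqrt (2 * pi * s\<^sup>2)"
  have B: "0 \<le> B" "normal_density 0 s x \<le> B" for x
    using normal_density_bound[OF s] by (auto simp: B_def)
  show ?thesis
  proof (rule Bochner_Integration.integrable_bound)
    show "integrable lborel (\<lambda>x. complex_of_real B * f x)"
      using f by simp
    show "AE x in lborel. norm (complex_of_real (normal_density 0 s (y - x)) * f x)
        \<le> norm (complex_of_real B * f x)"
      using B by (auto simp: norm_mult intro!: mult_right_mono AE_I2)
  qed (use borel_measurable_integrable[OF f] in simp)
qed

text \<open>The density has mass one, so the difference is an average of
  \<open>f (y - u) - f y\<close>; Tonelli then produces translation moduli. Rescaling
  \<open>u\<close> moves \<open>s\<close> from the weight into the shift, leaving a fixed weight
  suited to dominated convergence.\<close>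

lemma gauss_conv_dist_le:
  assumes s: "0 < s" and f: "integrable lborel f"
  shows "(\<integral>\<^sup>+y. ennreal (norm (gauss_conv s f y - f y)) \<partial>lborel)
     \<le> (\<integral>\<^sup>+u. ennreal (normal_density 0 1 u) * shift_dist f (- (s * u)) \<partial>lborel)"
proof -
  have [measurable]: "f \<in> borel_measurable borel"
    using borel_measurable_integrable[OF f] by simp
  have 1: "ennreal (norm (gauss_conv s f y - f y))
      \<le> (\<integral>\<^sup>+u. ennreal (normal_density 0 s u) * ennreal (norm (f (y + - u) - f y)) \<partial>lborel)" for y
  proof -
    have i1: "integrable lborel (\<lambda>u. complex_of_real (normal_density 0 s u) * f (y + - u))"
      using lborel_integrable_real_affine[OF integrable_gauss_conv_kernel[OF s f, of y], of "-1" y] by simp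
    have i2: "integrable lborel (\<lambda>u. complex_of_real (normal_density 0 s u) * f y)"
      using integrable_normal_density[OF s, of 0] by (simp add: integrable_of_real)
    have "gauss_conv s f y = (LINT u|lborel. complex_of_real (normal_density 0 s u) * f (y + - u))"
      unfolding gauss_conv_def
      using lborel_integral_real_affine[of "-1" "\<lambda>x. complex_of_real (normal_density 0 s (y - x)) * f x" y]
      by simp
    \<comment> \<open>Mass one of the density lets \<open>f y\<close> enter under the same integral
      as the convolution.\<close>
    moreover have "f y = (LINT u|lborel. complex_of_real (normal_density 0 s u) * f y)"
      using integral_normal_density[OF s, of 0] by simp
    ultimately have "gauss_conv s f y - f y = (LINT u|lborel. complex_of_real (normal_density 0 s u) * f (y + - u)
        - complex_of_real (normal_density 0 s u) * f y)"
      using i1 i2 by (simp add: Bochner_Integration.integral_diff)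
    then have "ennreal (norm (gauss_conv s f y - f y)) \<le> (\<integral>\<^sup>+u. ennreal (norm (complex_of_real (normal_density 0 s u) * f (y + - u)
        - complex_of_real (normal_density 0 s u) * f y)) \<partial>lborel)"
      using integral_norm_bound_ennreal[OF Bochner_Integration.integrable_diff[OF i1 i2]] by simp
    also have "\<dots> = (\<integral>\<^sup>+u. ennreal (normal_density 0 s u) * ennreal (norm (f (y + - u) - f y)) \<partial>lborel)"
      by (intro nn_integral_cong)
         (simp add: norm_mult ennreal_mult'[symmetric] right_diff_distrib[symmetric])
    finally show ?thesis .
  qed
  have "(\<integral>\<^sup>+y. ennreal (norm (gauss_conv s f y - f y)) \<partial>lborel)
     \<le> (\<integral>\<^sup>+y. \<integral>\<^sup>+u. ennreal (normal_density 0 s u) * ennreal (norm (f (y + - u) - f y)) \<partial>lborel \<partial>lborel)"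
    by (intro nn_integral_mono 1)
  also have "\<dots> = (\<integral>\<^sup>+u. \<integral>\<^sup>+y. ennreal (normal_density 0 s u) * ennreal (norm (f (y + - u) - f y)) \<partial>lborel \<partial>lborel)"
    by (rule lborel_pair.Fubini') simp
  also have "\<dots> = (\<integral>\<^sup>+u. ennreal (normal_density 0 s u) * shift_dist f (- u) \<partial>lborel)"
    unfolding shift_dist_def by (intro nn_integral_cong nn_integral_cmult) simp
  \<comment> \<open>Substitution of \<open>s * u\<close> for \<open>u\<close>; the Jacobian
    \<open>s\<close> will cancel the factor \<open>1 / s\<close> in the density of standard
    deviation \<open>s\<close>.\<close>
  also have "\<dots> = ennreal s * (\<integral>\<^sup>+u. ennreal (normal_density 0 s (s * u)) * shift_dist f (- (s * u)) \<partial>lborel)"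
    using s nn_integral_real_affine[of "\<lambda>u. ennreal (normal_density 0 s u) * shift_dist f (- u)" s 0]
    unfolding shift_dist_def by simp
  also have "\<dots> = (\<integral>\<^sup>+u. ennreal s * (ennreal (normal_density 0 s (s * u)) * shift_dist f (- (s * u))) \<partial>lborel)"
    unfolding shift_dist_def by (subst nn_integral_cmult) simp_all
  also have "\<dots> = (\<integral>\<^sup>+u. ennreal (normal_density 0 1 u) * shift_dist f (- (s * u)) \<partial>lborel)"
  proof (intro nn_integral_cong)
    fix u
    have "s * normal_density 0 s (s * u) = normal_density 0 1 u"
      using s by (simp add: normal_density_def real_sqrt_mult power_mult_distrib)
    then show "ennreal s * (ennreal (normal_density 0 s (s * u)) * shift_dist f (- (s * u)))
      = ennreal (normal_density 0 1 u) * shift_dist f (- (s * u))"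
      using s by (simp add: mult.assoc[symmetric] ennreal_mult'[symmetric])
  qed
  finally show ?thesis .
qed

text \<open>Dominated convergence in \<open>u\<close>: for each \<open>u\<close> the modulus at
  \<open>- (s n * u)\<close> vanishes in the limit, and \<open>shift_dist_bound\<close> gives a
  constant multiple of the standard normal density as majorant.\<close>

lemma gauss_conv_tendsto_L1:
  assumes f: "integrable lborel f" and s: "\<And>n. 0 < s n" "s \<longlonglongrightarrow> 0"
  shows "(\<lambda>n. \<integral>\<^sup>+y. ennreal (norm (gauss_conv (s n) f y - f y)) \<partial>lborel) \<longlonglongrightarrow> 0"
proof -
  have [measurable]: "f \<in> borel_measurable borel"
    using borel_measurable_integrable[OF f] by simp
  let ?C = "2 * (\<integral>\<^sup>+x. ennreal (norm (f x)) \<partial>lborel)"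
  have C: "?C < top"
    using f by (simp add: integrable_iff_bounded ennreal_mult_less_top)
  have "(\<lambda>n. \<integral>\<^sup>+u. ennreal (normal_density 0 1 u) * shift_dist f (- (s n * u)) \<partial>lborel)
     \<longlonglongrightarrow> (\<integral>\<^sup>+u. 0 \<partial>(lborel :: real measure))"
  proof (rule nn_integral_dominated_convergence[where w="\<lambda>u. ennreal (normal_density 0 1 u) * ?C"])
    show "(\<integral>\<^sup>+u. ennreal (normal_density 0 1 u) * ?C \<partial>lborel) < \<infinity>"
      using C by (subst nn_integral_multc) (simp_all add: nn_integral_normal_density)
    show "AE u in lborel. (\<lambda>n. ennreal (normal_density 0 1 u) * shift_dist f (- (s n * u))) \<longlonglongrightarrow> 0"
    proof (rule AE_I2)
      fix u
      have "(\<lambda>n. - (s n * u)) \<longlonglongrightarrow> - (0 * u)"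
        by (intro tendsto_intros s)
      then have "(\<lambda>n. shift_dist f (- (s n * u))) \<longlonglongrightarrow> 0"
        by (intro shift_dist_tendsto_zero[OF f]) simp
      from ennreal_tendsto_cmult[OF _ this, of "ennreal (normal_density 0 1 u)"]
      show "(\<lambda>n. ennreal (normal_density 0 1 u) * shift_dist f (- (s n * u))) \<longlonglongrightarrow> 0"
        by simp
    qed
  qed (auto simp: shift_dist_bound intro!: AE_I2 mult_left_mono, simp_all add: shift_dist_def)
  then have *: "(\<lambda>n. \<integral>\<^sup>+u. ennreal (normal_density 0 1 u) * shift_dist f (- (s n * u)) \<partial>lborel) \<longlonglongrightarrow> 0"
    by simp
  show ?thesis
  proof (rule tendsto_sandwich)
    show "\<forall>\<^sub>F n in sequentially. 0 \<le> (\<integral>\<^sup>+y. ennreal (norm (gauss_conv (s n) f y - f y)) \<partial>lborel)"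
      by simp
    show "\<forall>\<^sub>F n in sequentially. (\<integral>\<^sup>+y. ennreal (norm (gauss_conv (s n) f y - f y)) \<partial>lborel)
        \<le> (\<integral>\<^sup>+u. ennreal (normal_density 0 1 u) * shift_dist f (- (s n * u)) \<partial>lborel)"
      by (intro always_eventually allI gauss_conv_dist_le f s)
  qed (use * in auto)
qed

lemma gauss_conv_AE_subseq:
  assumes f: "integrable lborel f" and s: "\<And>n. 0 < s n" "s \<longlonglongrightarrow> 0"
  shows "\<exists>r::nat \<Rightarrow> nat. strict_mono r \<and> (AE y in lborel. (\<lambda>n. gauss_conv (s (r n)) f y) \<longlonglongrightarrow> f y)"
proof -
  have [measurable]: "f \<in> borel_measurable borel"
    using borel_measurable_integrable[OF f] by simp
  \<comment> \<open>The L1 estimate, with the moduli bounded uniformly, also makes each difference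
    integrable, as extraction of an almost everywhere convergent subsequence requires.\<close>
  have int: "integrable lborel (\<lambda>y. gauss_conv (s n) f y - f y)" for n
  proof -
    have "(\<integral>\<^sup>+u. ennreal (normal_density 0 1 u) * shift_dist f (- (s n * u)) \<partial>lborel)
       \<le> (\<integral>\<^sup>+u. ennreal (normal_density 0 1 u) * (2 * (\<integral>\<^sup>+x. ennreal (norm (f x)) \<partial>lborel)) \<partial>lborel)"
      by (intro nn_integral_mono mult_left_mono shift_dist_bound) auto
    also have "\<dots> < \<infinity>"
      using f by (subst nn_integral_multc) (simp_all add: nn_integral_normal_density integrable_iff_bounded ennreal_mult_less_top)
    finally show ?thesis
      using gauss_conv_dist_le[OF s(1) f, of n] by (intro integrableI_bounded) auto
  qed
  have "(\<lambda>n. enn2real (\<integral>\<^sup>+y. ennreal (norm (gauss_conv (s n) f y - f y)) \<partial>lborel)) \<longlonglongrightarrow> 0"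
    using gauss_conv_tendsto_L1[OF f s] by (intro tendsto_enn2real) auto
  then have "(\<lambda>n. LINT y|lborel. norm (gauss_conv (s n) f y - f y)) \<longlonglongrightarrow> 0"
    by (subst integral_eq_nn_integral) auto
  from tendsto_L1_AE_subseq[OF int this] obtain r :: "nat \<Rightarrow> nat" where r: "strict_mono r"
    "AE y in lborel. (\<lambda>n. gauss_conv (s (r n)) f y - f y) \<longlonglongrightarrow> 0" by blast
  from r(2) have "AE y in lborel. (\<lambda>n. gauss_conv (s (r n)) f y) \<longlonglongrightarrow> f y"
    by eventually_elim (simp add: LIM_zero_iff)
  with r(1) show ?thesis by blast
qed

subsection \<open>Plancherel on the line and in the plane\<close>

lemma borel_measurable_cnj [measurable (raw)]:
  "f \<in> borel_measurable M \<Longrightarrow> (\<lambda>x. cnj (f x)) \<in> borel_measurable M"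
  by (rule borel_measurable_continuous_on[of cnj]) (auto intro!: continuous_intros)

text \<open>Expand the square into a double integral over \<open>x\<close> and \<open>x'\<close>,
  then integrate over \<open>\<xi>\<close> first. The right side depends on \<open>K\<close> only
  through its Gram kernel, so two kernels with equal Gram kernels yield transforms of equal L2
  norm.\<close>

lemma nn_integral_norm_kernel_transform:
  fixes f :: "real \<Rightarrow> complex" and K :: "real \<Rightarrow> real \<Rightarrow> complex"
  assumes f: "integrable lborel f"
    and [measurable]: "(\<lambda>(x, \<xi>). K x \<xi>) \<in> borel_measurable (lborel \<Otimes>\<^sub>M lborel)"
    and bound: "\<And>x \<xi>. norm (K x \<xi>) \<le> B"
    and mass: "\<And>x. (\<integral>\<^sup>+\<xi>. ennreal (norm (K x \<xi>)) \<partial>lborel) \<le> ennreal C"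
  shows "(\<integral>\<^sup>+\<xi>. ennreal ((norm (LINT x|lborel. K x \<xi> * f x))\<^sup>2) \<partial>lborel) =
     ennreal (Re (LINT p|lborel. f (fst p) * cnj (f (snd p)) * (LINT \<xi>|lborel. K (fst p) \<xi> * cnj (K (snd p) \<xi>))))"
proof -
  have fm [measurable]: "f \<in> borel_measurable borel"
    using borel_measurable_integrable[OF f] by simp
  have [measurable]: "(\<lambda>p. K (fst p) (snd p)) \<in> borel_measurable (borel \<Otimes>\<^sub>M borel)"
    using assms(2) by (simp add: case_prod_beta' cong: measurable_cong_sets sets_pair_measure_cong)
  have Kx[measurable]: "K x \<in> borel_measurable borel" for x
    using measurable_compose[OF measurable_Pair1'[of x borel borel], of "\<lambda>p. K (fst p) (snd p)" borel] by simp
  have Kxi[measurable]: "(\<lambda>x. K x \<xi>) \<in> borel_measurable borel" for \<xi>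
    using measurable_compose[OF measurable_Pair2'[of \<xi> borel borel], of "\<lambda>p. K (fst p) (snd p)" borel] by simp
  have B: "0 \<le> B" using bound[of 0 0] norm_ge_zero order_trans by blast
  define g where "g \<xi> = (LINT x|lborel. K x \<xi> * f x)" for \<xi>
  have gm[measurable]: "g \<in> borel_measurable borel"
    unfolding g_def by measurable
  define \<Phi> where "\<Phi> p \<xi> = (K (fst p) \<xi> * f (fst p)) * cnj (K (snd p) \<xi> * f (snd p))" for p \<xi>
  have [measurable]: "(\<lambda>q. \<Phi> (fst q) (snd q)) \<in> borel_measurable ((borel \<Otimes>\<^sub>M borel) \<Otimes>\<^sub>M borel)"
    unfolding \<Phi>_def by measurable
  have Kf: "integrable lborel (\<lambda>x. K x \<xi> * f x)" for \<xi>
  proof (rule Bochner_Integration.integrable_bound)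
    show "integrable lborel (\<lambda>x. complex_of_real B * f x)" using f by simp
    show "AE x in lborel. norm (K x \<xi> * f x) \<le> norm (complex_of_real B * f x)"
      using bound B by (auto simp: norm_mult intro!: mult_right_mono AE_I2)
  qed simp
  \<comment> \<open>One factor \<open>K\<close> is bounded by \<open>B\<close>, the other integrates
    over \<open>\<xi>\<close> to at most \<open>C\<close>; what remains is the square of the L1 norm
    of \<open>f\<close>. This is the absolute integrability behind Fubini.\<close>
  have bnd: "(\<integral>\<^sup>+p. (\<integral>\<^sup>+\<xi>. ennreal (norm (\<Phi> p \<xi>)) \<partial>lborel) \<partial>(lborel \<Otimes>\<^sub>M lborel)) < \<infinity>"
  proof -
    have "(\<integral>\<^sup>+\<xi>. ennreal (norm (\<Phi> p \<xi>)) \<partial>lborel) \<le> ennreal (B * C) * (ennreal (norm (f (fst p))) * ennreal (norm (f (snd p))))" for p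
    proof -
      have "(\<integral>\<^sup>+\<xi>. ennreal (norm (\<Phi> p \<xi>)) \<partial>lborel)
        \<le> (\<integral>\<^sup>+\<xi>. ennreal (B * (norm (f (fst p)) * norm (f (snd p)))) * ennreal (norm (K (fst p) \<xi>)) \<partial>lborel)"
      proof (intro nn_integral_mono)
        fix \<xi>
        have "norm (\<Phi> p \<xi>) = norm (K (snd p) \<xi>) * ((norm (f (fst p)) * norm (f (snd p))) * norm (K (fst p) \<xi>))"
          by (simp add: \<Phi>_def norm_mult mult_ac)
        also have "\<dots> \<le> B * ((norm (f (fst p)) * norm (f (snd p))) * norm (K (fst p) \<xi>))"
          by (intro mult_right_mono bound) auto
        finally show "ennreal (norm (\<Phi> p \<xi>)) \<le> ennreal (B * (norm (f (fst p)) * norm (f (snd p)))) * ennreal (norm (K (fst p) \<xi>))"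
          using B by (subst ennreal_mult[symmetric]) (auto simp: mult.assoc intro!: ennreal_leI)
      qed
      also have "\<dots> = ennreal (B * (norm (f (fst p)) * norm (f (snd p)))) * (\<integral>\<^sup>+\<xi>. ennreal (norm (K (fst p) \<xi>)) \<partial>lborel)"
        by (rule nn_integral_cmult) simp
      also have "\<dots> \<le> ennreal (B * (norm (f (fst p)) * norm (f (snd p)))) * ennreal C"
        by (intro mult_left_mono mass) simp
      also have "\<dots> = ennreal (B * C) * (ennreal (norm (f (fst p))) * ennreal (norm (f (snd p))))"
        using B by (subst ennreal_mult'[of B C], simp) (simp add: ennreal_mult mult_ac)
      finally show ?thesis .
    qed
    then have "(\<integral>\<^sup>+p. (\<integral>\<^sup>+\<xi>. ennreal (norm (\<Phi> p \<xi>)) \<partial>lborel) \<partial>(lborel \<Otimes>\<^sub>M lborel))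
      \<le> (\<integral>\<^sup>+p. ennreal (B * C) * (ennreal (norm (f (fst p))) * ennreal (norm (f (snd p)))) \<partial>(lborel \<Otimes>\<^sub>M lborel))"
      by (intro nn_integral_mono)
    also have "\<dots> = ennreal (B * C) * ((\<integral>\<^sup>+x. ennreal (norm (f x)) \<partial>lborel) * (\<integral>\<^sup>+x. ennreal (norm (f x)) \<partial>lborel))"
      by (simp add: nn_integral_cmult lborel.nn_integral_fst[symmetric] nn_integral_multc)
    also have "\<dots> < \<infinity>"
      using f by (simp add: integrable_iff_bounded ennreal_mult_less_top)
    finally show ?thesis .
  qed
  interpret P: sigma_finite_measure "lborel \<Otimes>\<^sub>M lborel :: (real \<times> real) measure"
    unfolding lborel_prod by (rule sigma_finite_lborel)
  interpret PP: pair_sigma_finite "lborel \<Otimes>\<^sub>M lborel :: (real \<times> real) measure" "lborel :: real measure"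
    by unfold_locales
  have int: "integrable ((lborel \<Otimes>\<^sub>M lborel) \<Otimes>\<^sub>M lborel) (\<lambda>(p, \<xi>). \<Phi> p \<xi>)"
  proof (rule integrableI_bounded)
    show "(\<lambda>(p, \<xi>). \<Phi> p \<xi>) \<in> borel_measurable ((lborel \<Otimes>\<^sub>M lborel) \<Otimes>\<^sub>M lborel)"
      by (simp add: case_prod_beta')
    then show "(\<integral>\<^sup>+q. ennreal (norm (case q of (p, \<xi>) \<Rightarrow> \<Phi> p \<xi>)) \<partial>((lborel \<Otimes>\<^sub>M lborel) \<Otimes>\<^sub>M lborel)) < \<infinity>"
      using bnd by (subst lborel.nn_integral_fst[symmetric]) auto
  qed
  \<comment> \<open>At fixed \<open>\<xi>\<close> the integrand separates into a function of
    \<open>x\<close> times the conjugate of the same function of \<open>x'\<close>, so the double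
    integral is \<open>g \<xi> * cnj (g \<xi>)\<close>.\<close>
  have inner: "(LINT p|(lborel \<Otimes>\<^sub>M lborel). \<Phi> p \<xi>) = complex_of_real ((norm (g \<xi>))\<^sup>2)" for \<xi>
  proof -
    have "integrable (lborel \<Otimes>\<^sub>M lborel) (\<lambda>p. \<Phi> p \<xi>)"
    proof (rule integrableI_bounded)
      have "(\<integral>\<^sup>+p. ennreal (norm (\<Phi> p \<xi>)) \<partial>(lborel \<Otimes>\<^sub>M lborel)) =
        (\<integral>\<^sup>+x. ennreal (norm (K x \<xi> * f x)) \<partial>lborel) * (\<integral>\<^sup>+x. ennreal (norm (K x \<xi> * f x)) \<partial>lborel)"
        unfolding \<Phi>_def
        by (simp add: norm_mult[of "_ * _" "cnj _ * cnj _"] norm_mult[of "_ * _" "cnj (_ * _)"] ennreal_mult nn_integral_cmult lborel.nn_integral_fst[symmetric] nn_integral_multc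
            del: complex_cnj_mult)
      also have "\<dots> < \<infinity>"
        using Kf[of \<xi>] by (simp add: integrable_iff_bounded ennreal_mult_less_top)
      finally show "(\<integral>\<^sup>+p. ennreal (norm (\<Phi> p \<xi>)) \<partial>(lborel \<Otimes>\<^sub>M lborel)) < \<infinity>" .
    qed (simp add: \<Phi>_def)
    then have "(LINT p|(lborel \<Otimes>\<^sub>M lborel). \<Phi> p \<xi>) = (LINT x|lborel. LINT x'|lborel. \<Phi> (x, x') \<xi>)"
      by (rule lborel_pair.integral_fst'[symmetric])
    also have "\<dots> = (LINT x|lborel. (K x \<xi> * f x) * cnj (g \<xi>))"
      unfolding \<Phi>_def fst_conv snd_conv g_def
      by (simp only: integral_mult_right_zero Bochner_Integration.integral_cnj)
    also have "\<dots> = g \<xi> * cnj (g \<xi>)"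
      unfolding g_def by (subst integral_mult_left_zero) simp
    finally show ?thesis by (simp only: complex_norm_square)
  qed
  have gint: "integrable lborel (\<lambda>\<xi>. complex_of_real ((norm (g \<xi>))\<^sup>2))"
    using PP.integrable_snd[OF int] by (simp add: inner del: of_real_power)
  then have gint': "integrable lborel (\<lambda>\<xi>. (norm (g \<xi>))\<^sup>2)"
    using integrable_Re by fastforce
  have "complex_of_real (LINT \<xi>|lborel. (norm (g \<xi>))\<^sup>2) = (LINT \<xi>|lborel. (LINT p|(lborel \<Otimes>\<^sub>M lborel). \<Phi> p \<xi>))"
    by (simp add: inner del: of_real_power)
  also have "\<dots> = (LINT p|(lborel \<Otimes>\<^sub>M lborel). LINT \<xi>|lborel. \<Phi> p \<xi>)"
    by (rule PP.Fubini_integral[OF int])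
  also have "\<dots> = (LINT p|lborel. f (fst p) * cnj (f (snd p)) * (LINT \<xi>|lborel. K (fst p) \<xi> * cnj (K (snd p) \<xi>)))"
  proof -
    have "\<Phi> p = (\<lambda>\<xi>. f (fst p) * cnj (f (snd p)) * (K (fst p) \<xi> * cnj (K (snd p) \<xi>)))" for p
      by (simp add: \<Phi>_def fun_eq_iff)
    then show ?thesis by (simp add: lborel_prod)
  qed
  finally have "(LINT \<xi>|lborel. (norm (g \<xi>))\<^sup>2) =
    Re (LINT p|lborel. f (fst p) * cnj (f (snd p)) * (LINT \<xi>|lborel. K (fst p) \<xi> * cnj (K (snd p) \<xi>)))"
    by (metis Re_complex_of_real)
  moreover have "(\<integral>\<^sup>+\<xi>. ennreal ((norm (g \<xi>))\<^sup>2) \<partial>lborel) = ennreal (LINT \<xi>|lborel. (norm (g \<xi>))\<^sup>2)"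
    by (rule nn_integral_eq_integral[OF gint']) simp
  ultimately show ?thesis unfolding g_def by simp
qed

section \<open>Gaussian kernels in space and in frequency, with a common Gram kernel\<close>

definition fourier :: "('a::euclidean_space \<Rightarrow> complex) \<Rightarrow> 'a \<Rightarrow> complex" where
  "fourier f \<xi> = (LINT x|lborel. f x * exp (- 2 * \<i> * complex_of_real pi * complex_of_real (x \<bullet> \<xi>)))"

text \<open>The Fourier kernel damped by the Fourier transform of the centred normal density of
  standard deviation \<open>s\<close>. The damping gives it finite mass in
  \<open>\<xi>\<close>.\<close>

definition gauss_char :: "real \<Rightarrow> real \<Rightarrow> real \<Rightarrow> complex" where
  "gauss_char s x \<xi> = complex_of_real (exp (- 2 * pi\<^sup>2 * s\<^sup>2 * \<xi>\<^sup>2)) * exp (- 2 * \<i> * complex_of_real pi * complex_of_real (x * \<xi>))"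

lemma norm_gauss_char: "norm (gauss_char s x \<xi>) = exp (- 2 * pi\<^sup>2 * s\<^sup>2 * \<xi>\<^sup>2)"
  unfolding gauss_char_def norm_mult by (simp add: norm_exp_eq_Re)

lemma gauss_char_mass:
  assumes "0 < s"
  obtains C where "\<And>x. (\<integral>\<^sup>+\<xi>. ennreal (norm (gauss_char s x \<xi>)) \<partial>lborel) \<le> ennreal C"
proof
  \<comment> \<open>Chosen so that
    \<open>1 / (2 * \<tau>\<^sup>2) = 2 * pi\<^sup>2 * s\<^sup>2\<close>: the damping is an
    unnormalised normal density of standard deviation \<open>\<tau>\<close>.\<close>
  define \<tau> where "\<tau> = 1 / (2 * pi * s)"
  have \<tau>: "0 < \<tau>" using assms by (simp add: \<tau>_def)
  fix x
  have eq: "norm (gauss_char s x \<xi>) = sqrt (2 * pi * \<tau>\<^sup>2) * normal_density 0 \<tau> \<xi>" for \<xi>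
  proof -
    have "\<xi>\<^sup>2 / (2 * \<tau>\<^sup>2) = 2 * pi\<^sup>2 * s\<^sup>2 * \<xi>\<^sup>2"
      by (simp add: \<tau>_def power_mult_distrib power_divide)
    then show ?thesis
      using \<tau> by (simp add: norm_gauss_char normal_density_def)
  qed
  show "(\<integral>\<^sup>+\<xi>. ennreal (norm (gauss_char s x \<xi>)) \<partial>lborel) \<le> ennreal (sqrt (2 * pi * \<tau>\<^sup>2))"
    unfolding eq using \<tau> by (simp add: ennreal_mult nn_integral_cmult nn_integral_normal_density)
qed

text \<open>The product of the kernels is a Gaussian times a character in \<open>\<xi>\<close>, so
  after rescaling its integral is a value of the characteristic function of the standard normal
  law.\<close>

lemma gauss_char_gram:
  assumes s: "0 < s"
  shows "(LINT \<xi>|lborel. gauss_char s x \<xi> * cnj (gauss_char s x' \<xi>))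
     = complex_of_real (normal_density 0 (sqrt 2 * s) (x - x'))"
proof -
  \<comment> \<open>The two dampings multiply to \<open>exp (- (a * \<xi>)\<^sup>2 / 2)\<close>,
    which fixes \<open>a\<close>. The frequency \<open>t\<close> is then fixed by
    \<open>t * a = - 2 * pi * (x - x')\<close>.\<close>
  define a where "a = 2 * sqrt 2 * pi * s"
  define t where "t = - 2 * pi * (x - x') / a"
  have a: "0 < a" using s by (simp add: a_def)
  have a2: "a\<^sup>2 = 8 * pi\<^sup>2 * s\<^sup>2" by (simp add: a_def power_mult_distrib)
  have "complex_of_real (exp (- (t\<^sup>2) / 2)) = char std_normal_distribution t"
    by (simp add: char_std_normal_distribution)
  also have "\<dots> = (LINT x|lborel. std_normal_density x *\<^sub>R iexp (t * x))"
    unfolding char_def by (subst integral_density) (auto intro!: borel_measurable_continuous_onI continuous_intros)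
  also have "\<dots> = a *\<^sub>R (LINT \<xi>|lborel. std_normal_density (a * \<xi>) *\<^sub>R iexp (t * (a * \<xi>)))"
    using lborel_integral_real_affine[of a "\<lambda>x. std_normal_density x *\<^sub>R iexp (t * x)" 0] a by simp
  also have "(\<lambda>\<xi>. std_normal_density (a * \<xi>) *\<^sub>R iexp (t * (a * \<xi>))) =
      (\<lambda>\<xi>. (1 / sqrt (2 * pi)) *\<^sub>R (gauss_char s x \<xi> * cnj (gauss_char s x' \<xi>)))"
  proof
    fix \<xi> :: real
    have 1: "std_normal_density (a * \<xi>) = (1 / sqrt (2 * pi)) * (exp (- 2 * pi\<^sup>2 * s\<^sup>2 * \<xi>\<^sup>2) * exp (- 2 * pi\<^sup>2 * s\<^sup>2 * \<xi>\<^sup>2))"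
      by (simp add: std_normal_density_def power_mult_distrib a2 flip: exp_add)
    have ta: "t * (a * \<xi>) = - 2 * pi * (x * \<xi>) + 2 * pi * (x' * \<xi>)"
      using a by (simp add: t_def field_simps)
    have 2: "iexp (t * (a * \<xi>)) = exp (- 2 * \<i> * complex_of_real pi * complex_of_real (x * \<xi>))
        * cnj (exp (- 2 * \<i> * complex_of_real pi * complex_of_real (x' * \<xi>)))"
      unfolding ta exp_cnj exp_add[symmetric] by (simp add: algebra_simps)
    show "std_normal_density (a * \<xi>) *\<^sub>R iexp (t * (a * \<xi>)) = (1 / sqrt (2 * pi)) *\<^sub>R (gauss_char s x \<xi> * cnj (gauss_char s x' \<xi>))"
      unfolding 1 2 gauss_char_def by (simp add: scaleR_conv_of_real mult_ac)
  qed
  also have "a *\<^sub>R (LINT \<xi>|lborel. (1 / sqrt (2 * pi)) *\<^sub>R (gauss_char s x \<xi> * cnj (gauss_char s x' \<xi>)))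
     = (a / sqrt (2 * pi)) *\<^sub>R (LINT \<xi>|lborel. gauss_char s x \<xi> * cnj (gauss_char s x' \<xi>))"
    by (simp only: integral_scaleR_right) simp
  finally have "(sqrt (2 * pi) / a) *\<^sub>R complex_of_real (exp (- (t\<^sup>2) / 2)) =
     (LINT \<xi>|lborel. gauss_char s x \<xi> * cnj (gauss_char s x' \<xi>))"
    using a by simp
  moreover have "(sqrt (2 * pi) / a) * exp (- (t\<^sup>2) / 2) = normal_density 0 (sqrt 2 * s) (x - x')"
  proof -
    have e: "- (t\<^sup>2) / 2 = - ((x - x')\<^sup>2) / (4 * s\<^sup>2)"
    proof -
      define d where "d = x - x'"
      have "t\<^sup>2 = (2 * pi * d)\<^sup>2 / a\<^sup>2"
        unfolding t_def d_def[symmetric] by (simp add: power_divide)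
      also have "\<dots> / 2 = d\<^sup>2 / (4 * s\<^sup>2)"
        using s by (simp add: a2 power_mult_distrib field_simps)
      finally show ?thesis by (simp add: d_def)
    qed
    have f: "sqrt (2 * pi) / a = 1 / sqrt (4 * pi * s\<^sup>2)"
      using s by (simp add: a_def real_sqrt_mult field_simps)
    show ?thesis
      unfolding e f using s by (simp add: normal_density_def power_mult_distrib)
  qed
  ultimately show ?thesis by (metis scaleR_conv_of_real of_real_mult)
qed

text \<open>Variances add under convolution of centred normal densities:
  \<open>s\<^sup>2 + s\<^sup>2\<close> is the square of \<open>sqrt 2 * s\<close>.\<close>

lemma gauss_conv_gram:
  assumes s: "0 < s"
  shows "(LINT y|lborel. complex_of_real (normal_density 0 s (y - x)) * cnj (complex_of_real (normal_density 0 s (y - x'))))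
     = complex_of_real (normal_density 0 (sqrt 2 * s) (x - x'))"
proof -
  have [simp]: "sqrt (2 * s\<^sup>2) = sqrt 2 * s"
    using s by (simp add: real_sqrt_mult)
  have even: "normal_density 0 s (x - y) = normal_density 0 s (y - x)" for y
    by (simp add: normal_density_def power2_commute)
  have "ennreal (normal_density 0 (sqrt 2 * s) (x - x'))
     = (\<integral>\<^sup>+y. ennreal (normal_density 0 s (x - x' - y) * normal_density 0 s y) \<partial>lborel)"
    using fun_cong[OF conv_normal_density_zero_mean[OF s s], of "x - x'"] by simp
  \<comment> \<open>Translating by \<open>- x'\<close> turns the factors into densities at
    \<open>x - y\<close> and \<open>y - x'\<close>; evenness then reverses the first.\<close>
  also have "\<dots> = (\<integral>\<^sup>+y. ennreal (normal_density 0 s (x - x' - (y + - x')) * normal_density 0 s (y + - x')) \<partial>lborel)"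
    by (rule nn_integral_shift[symmetric]) simp
  also have "\<dots> = (\<integral>\<^sup>+y. ennreal (normal_density 0 s (y - x) * normal_density 0 s (y - x')) \<partial>lborel)"
    by (simp add: even)
  finally have "(LINT y|lborel. normal_density 0 s (y - x) * normal_density 0 s (y - x')) = normal_density 0 (sqrt 2 * s) (x - x')"
    by (subst integral_eq_nn_integral) (auto simp: normal_density_nonneg dest: sym)
  then show ?thesis
    by (simp flip: of_real_mult)
qed

lemma borel_measurable_fourier [measurable]:
  fixes f :: "'a::euclidean_space \<Rightarrow> complex"
  assumes [measurable]: "f \<in> borel_measurable borel"
  shows "fourier f \<in> borel_measurable borel"
  unfolding fourier_def by measurable

text \<open>Both sides are squared norms of kernel transforms of \<open>f\<close>, and the two Gram
  kernels coincide by \<open>gauss_char_gram\<close> and \<open>gauss_conv_gram\<close>.\<close>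

lemma nn_integral_gauss_conv_eq:
  fixes f :: "real \<Rightarrow> complex"
  assumes f: "integrable lborel f" and s: "0 < s"
  shows "(\<integral>\<^sup>+y. ennreal ((norm (gauss_conv s f y))\<^sup>2) \<partial>lborel) =
    (\<integral>\<^sup>+\<xi>. ennreal ((exp (- 2 * pi\<^sup>2 * s\<^sup>2 * \<xi>\<^sup>2) * norm (fourier f \<xi>))\<^sup>2) \<partial>lborel)"
proof -
  obtain C where C: "\<And>x. (\<integral>\<^sup>+\<xi>. ennreal (norm (gauss_char s x \<xi>)) \<partial>lborel) \<le> ennreal C"
    using gauss_char_mass[OF s] by blast
  have "(\<integral>\<^sup>+\<xi>. ennreal ((norm (LINT x|lborel. gauss_char s x \<xi> * f x))\<^sup>2) \<partial>lborel) =
    ennreal (Re (LINT p|lborel. f (fst p) * cnj (f (snd p)) * (LINT \<xi>|lborel. gauss_char s (fst p) \<xi> * cnj (gauss_char s (snd p) \<xi>))))"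
  proof (rule nn_integral_norm_kernel_transform[OF f])
    show "(\<lambda>(x, \<xi>). gauss_char s x \<xi>) \<in> borel_measurable (lborel \<Otimes>\<^sub>M lborel)"
      unfolding gauss_char_def by measurable
    show "norm (gauss_char s x \<xi>) \<le> 1" for x \<xi>
      unfolding norm_gauss_char by simp
  qed (rule C)
  moreover have "(\<integral>\<^sup>+y. ennreal ((norm (LINT x|lborel. complex_of_real (normal_density 0 s (y - x)) * f x))\<^sup>2) \<partial>lborel) =
    ennreal (Re (LINT p|lborel. f (fst p) * cnj (f (snd p)) * (LINT y|lborel. complex_of_real (normal_density 0 s (y - fst p))
       * cnj (complex_of_real (normal_density 0 s (y - snd p))))))"
  proof (rule nn_integral_norm_kernel_transform[OF f])
    show "norm (complex_of_real (normal_density 0 s (y - x))) \<le> 1 / sqrt (2 * pi * s\<^sup>2)" for x y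
      using normal_density_bound[OF s] by simp
    show "(\<integral>\<^sup>+y. ennreal (norm (complex_of_real (normal_density 0 s (y - x)))) \<partial>lborel) \<le> ennreal 1" for x
      using nn_integral_shift[of "\<lambda>y. ennreal (normal_density 0 s y)" "- x"] s
      by (simp add: nn_integral_normal_density)
  qed measurable
  moreover have "norm (LINT x|lborel. gauss_char s x \<xi> * f x) = exp (- 2 * pi\<^sup>2 * s\<^sup>2 * \<xi>\<^sup>2) * norm (fourier f \<xi>)" for \<xi>
  proof -
    have "(LINT x|lborel. gauss_char s x \<xi> * f x) = complex_of_real (exp (- 2 * pi\<^sup>2 * s\<^sup>2 * \<xi>\<^sup>2)) * fourier f \<xi>"
      unfolding fourier_def gauss_char_def integral_mult_right_zero[symmetric]
      by (intro Bochner_Integration.integral_cong) (simp_all add: mult_ac)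
    then show ?thesis by (simp add: norm_mult)
  qed
  ultimately show ?thesis
    unfolding gauss_conv_def gauss_char_gram[OF s] gauss_conv_gram[OF s] by simp
qed

text \<open>Cauchy-Schwarz with the density split into two square roots bounds the squared
  convolution by the convolution of the square, using mass one in \<open>x\<close>. Tonelli and mass
  one in \<open>y\<close> finish.\<close>

lemma nn_integral_gauss_conv_le:
  fixes f :: "real \<Rightarrow> complex"
  assumes f: "integrable lborel f" and s: "0 < s"
  shows "(\<integral>\<^sup>+y. ennreal ((norm (gauss_conv s f y))\<^sup>2) \<partial>lborel) \<le> (\<integral>\<^sup>+x. ennreal ((norm (f x))\<^sup>2) \<partial>lborel)"
proof -
  have [measurable]: "f \<in> borel_measurable borel"
    using borel_measurable_integrable[OF f] by simp
  let ?G = "\<lambda>y x. normal_density 0 s (y - x)"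
  have G1: "(\<integral>\<^sup>+x. ennreal (?G y x) \<partial>lborel) = 1" for y
    using nn_integral_real_affine[of "\<lambda>x. ennreal (normal_density 0 s x)" "-1" y] s
    by (simp add: nn_integral_normal_density)
  have G2: "(\<integral>\<^sup>+y. ennreal (?G y x) \<partial>lborel) = 1" for x
    using nn_integral_shift[of "\<lambda>y. ennreal (normal_density 0 s y)" "- x"] s
    by (simp add: nn_integral_normal_density)
  have "ennreal ((norm (gauss_conv s f y))\<^sup>2) \<le> (\<integral>\<^sup>+x. ennreal (?G y x) * ennreal ((norm (f x))\<^sup>2) \<partial>lborel)" for y
  proof -
    have "ennreal ((norm (gauss_conv s f y))\<^sup>2) = (ennreal (norm (gauss_conv s f y)))\<^sup>2"
      by (simp add: ennreal_power)
    also have "\<dots> \<le> (\<integral>\<^sup>+x. ennreal (norm (complex_of_real (?G y x) * f x)) \<partial>lborel)\<^sup>2"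
      unfolding gauss_conv_def
      by (intro power_mono integral_norm_bound_ennreal integrable_gauss_conv_kernel f s) auto
    also have "(\<integral>\<^sup>+x. ennreal (norm (complex_of_real (?G y x) * f x)) \<partial>lborel) =
      (\<integral>\<^sup>+x. ennreal (sqrt (?G y x)) * ennreal (sqrt (?G y x) * norm (f x)) \<partial>lborel)"
      by (intro nn_integral_cong) (simp add: norm_mult ennreal_mult[symmetric] mult.assoc[symmetric])
    also have "\<dots>\<^sup>2 \<le> (\<integral>\<^sup>+x. (ennreal (sqrt (?G y x)))\<^sup>2 \<partial>lborel) * (\<integral>\<^sup>+x. (ennreal (sqrt (?G y x) * norm (f x)))\<^sup>2 \<partial>lborel)"
      by (rule Cauchy_Schwarz_nn_integral) auto
    also have "\<dots> = (\<integral>\<^sup>+x. ennreal (?G y x) * ennreal ((norm (f x))\<^sup>2) \<partial>lborel)"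
      by (simp add: ennreal_power power_mult_distrib G1 ennreal_mult)
    finally show ?thesis .
  qed
  then have "(\<integral>\<^sup>+y. ennreal ((norm (gauss_conv s f y))\<^sup>2) \<partial>lborel)
     \<le> (\<integral>\<^sup>+y. \<integral>\<^sup>+x. ennreal (?G y x) * ennreal ((norm (f x))\<^sup>2) \<partial>lborel \<partial>lborel)"
    by (intro nn_integral_mono)
  also have "\<dots> = (\<integral>\<^sup>+x. \<integral>\<^sup>+y. ennreal (?G y x) * ennreal ((norm (f x))\<^sup>2) \<partial>lborel \<partial>lborel)"
    by (rule lborel_pair.Fubini') measurable
  also have "\<dots> = (\<integral>\<^sup>+x. ennreal ((norm (f x))\<^sup>2) \<partial>lborel)"
    by (simp add: nn_integral_multc G2)
  finally show ?thesis .
qed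

section \<open>Plancherel by letting the variance tend to zero\<close>

lemma nn_integral_norm_sq_le_limit:
  fixes u :: "nat \<Rightarrow> 'a \<Rightarrow> complex"
  assumes [measurable]: "\<And>n. u n \<in> borel_measurable M" "v \<in> borel_measurable M"
    and lim: "AE x in M. (\<lambda>n. u n x) \<longlonglongrightarrow> v x"
    and bound: "\<And>n. (\<integral>\<^sup>+x. ennreal ((norm (u n x))\<^sup>2) \<partial>M) \<le> C"
  shows "(\<integral>\<^sup>+x. ennreal ((norm (v x))\<^sup>2) \<partial>M) \<le> C"
proof -
  have "(\<integral>\<^sup>+x. ennreal ((norm (v x))\<^sup>2) \<partial>M) = (\<integral>\<^sup>+x. liminf (\<lambda>n. ennreal ((norm (u n x))\<^sup>2)) \<partial>M)"
  proof (rule nn_integral_cong_AE)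
    show "AE x in M. ennreal ((norm (v x))\<^sup>2) = liminf (\<lambda>n. ennreal ((norm (u n x))\<^sup>2))"
      using lim
    proof eventually_elim
      case (elim x)
      then have "(\<lambda>n. ennreal ((norm (u n x))\<^sup>2)) \<longlonglongrightarrow> ennreal ((norm (v x))\<^sup>2)"
        by (intro tendsto_intros tendsto_ennrealI)
      then show ?case by (intro lim_imp_Liminf[symmetric]) simp_all
    qed
  qed
  also have "\<dots> \<le> liminf (\<lambda>n. \<integral>\<^sup>+x. ennreal ((norm (u n x))\<^sup>2) \<partial>M)"
    by (rule nn_integral_liminf) measurable
  also have "\<dots> \<le> C"
    using Liminf_mono[of "\<lambda>n. \<integral>\<^sup>+x. ennreal ((norm (u n x))\<^sup>2) \<partial>M" "\<lambda>_. C" sequentially] bound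
    by (simp add: Liminf_const)
  finally show ?thesis .
qed

theorem plancherel_real:
  fixes f :: "real \<Rightarrow> complex"
  assumes f: "integrable lborel f"
  shows "(\<integral>\<^sup>+\<xi>. ennreal ((norm (fourier f \<xi>))\<^sup>2) \<partial>lborel) = (\<integral>\<^sup>+x. ennreal ((norm (f x))\<^sup>2) \<partial>lborel)"
proof (rule antisym)
  have [measurable]: "f \<in> borel_measurable borel"
    using borel_measurable_integrable[OF f] by simp
  \<comment> \<open>\<open>Suc\<close> keeps every term positive, since \<open>1 / 0\<close>
    evaluates to \<open>0\<close>.\<close>
  define s :: "nat \<Rightarrow> real" where "s n = 1 / real (Suc n)" for n
  have s: "0 < s n" "s \<longlonglongrightarrow> 0" for n
    unfolding s_def using LIMSEQ_Suc[OF lim_1_over_n] by auto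
  let ?w = "\<lambda>n \<xi>. exp (- 2 * pi\<^sup>2 * (s n)\<^sup>2 * \<xi>\<^sup>2)"
  have w: "norm (complex_of_real (?w n \<xi>) * fourier f \<xi>) = ?w n \<xi> * norm (fourier f \<xi>)" for n \<xi>
    by (simp add: norm_mult)
  \<comment> \<open>The damped transforms converge pointwise to \<open>fourier f\<close>, and each
    has the L2 norm of a Gaussian convolution, hence at most that of \<open>f\<close>.\<close>
  show "(\<integral>\<^sup>+\<xi>. ennreal ((norm (fourier f \<xi>))\<^sup>2) \<partial>lborel) \<le> (\<integral>\<^sup>+x. ennreal ((norm (f x))\<^sup>2) \<partial>lborel)"
  proof (rule nn_integral_norm_sq_le_limit[where u="\<lambda>n \<xi>. complex_of_real (?w n \<xi>) * fourier f \<xi>"])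
    show "AE \<xi> in lborel. (\<lambda>n. complex_of_real (?w n \<xi>) * fourier f \<xi>) \<longlonglongrightarrow> fourier f \<xi>"
    proof (rule AE_I2)
      fix \<xi> :: real
      have "(\<lambda>n. complex_of_real (?w n \<xi>) * fourier f \<xi>) \<longlonglongrightarrow> complex_of_real (exp (- 2 * pi\<^sup>2 * 0\<^sup>2 * \<xi>\<^sup>2)) * fourier f \<xi>"
        by (intro tendsto_intros s)
      then show "(\<lambda>n. complex_of_real (?w n \<xi>) * fourier f \<xi>) \<longlonglongrightarrow> fourier f \<xi>" by simp
    qed
    show "(\<integral>\<^sup>+\<xi>. ennreal ((norm (complex_of_real (?w n \<xi>) * fourier f \<xi>))\<^sup>2) \<partial>lborel) \<le> (\<integral>\<^sup>+x. ennreal ((norm (f x))\<^sup>2) \<partial>lborel)" for n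
      unfolding w nn_integral_gauss_conv_eq[OF f s(1), symmetric]
      by (rule nn_integral_gauss_conv_le[OF f s(1)])
  qed measurable
  obtain r :: "nat \<Rightarrow> nat" where r: "AE y in lborel. (\<lambda>n. gauss_conv (s (r n)) f y) \<longlonglongrightarrow> f y"
    using gauss_conv_AE_subseq[OF f s] by blast
  \<comment> \<open>Here the convolutions converge to \<open>f\<close> almost everywhere along
    \<open>r\<close>, and the damping factor is at most one on the frequency side.\<close>
  show "(\<integral>\<^sup>+x. ennreal ((norm (f x))\<^sup>2) \<partial>lborel) \<le> (\<integral>\<^sup>+\<xi>. ennreal ((norm (fourier f \<xi>))\<^sup>2) \<partial>lborel)"
  proof (rule nn_integral_norm_sq_le_limit[OF _ _ r])
    show "(\<integral>\<^sup>+y. ennreal ((norm (gauss_conv (s (r n)) f y))\<^sup>2) \<partial>lborel) \<le> (\<integral>\<^sup>+\<xi>. ennreal ((norm (fourier f \<xi>))\<^sup>2) \<partial>lborel)" for n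
      unfolding nn_integral_gauss_conv_eq[OF f s(1)]
      by (intro nn_integral_mono ennreal_leI power_mono mult_left_le_one_le) auto
  qed measurable
qed

text \<open>The partial transform \<open>g a\<close> in the first variable is integrable in
  \<open>y\<close> for every \<open>a\<close>, because the character \<open>e\<close> has modulus
  one. Plancherel is applied in \<open>y\<close> at fixed \<open>a\<close> and, after Tonelli, in
  \<open>x\<close> at fixed \<open>y\<close>.\<close>

theorem plancherel_plane:
  fixes f :: "real \<times> real \<Rightarrow> complex"
  assumes f: "integrable lborel f"
  shows "(\<integral>\<^sup>+\<xi>. ennreal ((norm (fourier f \<xi>))\<^sup>2) \<partial>lborel) = (\<integral>\<^sup>+x. ennreal ((norm (f x))\<^sup>2) \<partial>lborel)"
proof -
  have [measurable]: "f \<in> borel_measurable borel"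
    using borel_measurable_integrable[OF f] by simp
  have f2: "integrable (lborel \<Otimes>\<^sub>M lborel) f" using f by (simp add: lborel_prod)
  have [measurable]: "f \<in> borel_measurable (borel \<Otimes>\<^sub>M borel)"
    by (simp add: borel_prod)
  define e :: "real \<Rightarrow> complex" where "e t = exp (- 2 * \<i> * complex_of_real pi * complex_of_real t)" for t
  have [measurable]: "e \<in> borel_measurable borel" unfolding e_def by measurable
  have ne: "norm (e t) = 1" for t by (simp add: e_def norm_exp_eq_Re)
  define g where "g a = (\<lambda>y. LINT x|lborel. f (x, y) * e (x * a))" for a
  have gft: "g a y = fourier (\<lambda>x. f (x, y)) a" for a y
    by (simp add: g_def fourier_def e_def)
  have [measurable]: "(\<lambda>q. g (fst q) (snd q)) \<in> borel_measurable (borel \<Otimes>\<^sub>M borel)"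
    unfolding g_def by measurable
  have fe: "integrable (lborel \<Otimes>\<^sub>M lborel) (\<lambda>p. f p * e (fst p * a))" for a
    by (rule Bochner_Integration.integrable_bound[OF f2]) (auto simp: norm_mult ne)
  have gint: "integrable lborel (g a)" for a
    unfolding g_def using lborel_pair.integrable_snd[of "\<lambda>x y. f (x, y) * e (x * a)"] fe[of a]
    by (simp add: case_prod_beta')
  have ftg: "fourier f (a, b) = fourier (g a) b" for a b
  proof -
    have "integrable (lborel \<Otimes>\<^sub>M lborel) (\<lambda>p. f p * e (fst p * a) * e (snd p * b))"
      by (rule Bochner_Integration.integrable_bound[OF fe[of a]]) (auto simp: norm_mult ne)
    then have "(LINT y|lborel. LINT x|lborel. f (x, y) * e (x * a) * e (y * b)) =
       (LINT p|(lborel \<Otimes>\<^sub>M lborel). f p * e (fst p * a) * e (snd p * b))"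
      using lborel_pair.integral_snd[of "\<lambda>x y. f (x, y) * e (x * a) * e (y * b)"] by (simp add: case_prod_beta')
    also have "\<dots> = fourier f (a, b)"
      unfolding fourier_def lborel_prod e_def
      by (intro Bochner_Integration.integral_cong) (auto simp: inner_prod_def mult.assoc algebra_simps simp flip: exp_add)
    finally show ?thesis unfolding g_def fourier_def by (simp add: e_def)
  qed
  have "(\<integral>\<^sup>+\<xi>. ennreal ((norm (fourier f \<xi>))\<^sup>2) \<partial>lborel) = (\<integral>\<^sup>+a. \<integral>\<^sup>+b. ennreal ((norm (fourier f (a, b)))\<^sup>2) \<partial>lborel \<partial>lborel)"
    unfolding lborel_prod[symmetric]
    by (rule lborel.nn_integral_fst[symmetric]) (simp add: lborel_prod)
  also have "\<dots> = (\<integral>\<^sup>+a. \<integral>\<^sup>+y. ennreal ((norm (g a y))\<^sup>2) \<partial>lborel \<partial>lborel)"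
    by (simp add: ftg plancherel_real[OF gint])
  also have "\<dots> = (\<integral>\<^sup>+y. \<integral>\<^sup>+a. ennreal ((norm (g a y))\<^sup>2) \<partial>lborel \<partial>lborel)"
    by (rule lborel_pair.Fubini') (unfold g_def, measurable)
  also have "\<dots> = (\<integral>\<^sup>+y. \<integral>\<^sup>+x. ennreal ((norm (f (x, y)))\<^sup>2) \<partial>lborel \<partial>lborel)"
  \<comment> \<open>Fubini makes the sections of \<open>f\<close> at fixed \<open>y\<close>
    integrable for almost every \<open>y\<close> only.\<close>
  proof (rule nn_integral_cong_AE)
    have "AE y in lborel. integrable lborel (\<lambda>x. f (x, y))"
      using lborel_pair.AE_integrable_snd[of "\<lambda>x y. f (x, y)"] f2 by simp
    then show "AE y in lborel. (\<integral>\<^sup>+a. ennreal ((norm (g a y))\<^sup>2) \<partial>lborel) = (\<integral>\<^sup>+x. ennreal ((norm (f (x, y)))\<^sup>2) \<partial>lborel)"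
      by eventually_elim (simp add: gft plancherel_real)
  qed
  also have "\<dots> = (\<integral>\<^sup>+x. ennreal ((norm (f x))\<^sup>2) \<partial>lborel)"
    unfolding lborel_prod[symmetric]
    by (rule lborel_pair.nn_integral_snd) simp
  finally show ?thesis .
qed

subsection \<open>Polar coordinates\<close>

text \<open>The change of variables for absolutely integrable functions is an equivalence that also
  carries the value, which settles the finite case. If integrability fails on one side it fails on
  both, and for nonnegative functions both integrals are then infinite.\<close>

lemma nn_integral_substitution_inj:
  fixes f :: "real \<Rightarrow> real" and g g' :: "real \<Rightarrow> real"
  assumes S: "S \<in> sets borel" "g ` S \<in> sets borel"
    and f [measurable]: "f \<in> borel_measurable borel" and nn: "\<And>x. 0 \<le> f x"
    and [measurable]: "g \<in> borel_measurable borel" "g' \<in> borel_measurable borel"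
    and der: "\<And>x. x \<in> S \<Longrightarrow> (g has_field_derivative g' x) (at x)"
    and inj: "inj_on g S"
  shows "(\<integral>\<^sup>+y\<in>g ` S. ennreal (f y) \<partial>lborel) = (\<integral>\<^sup>+x\<in>S. ennreal (\<bar>g' x\<bar> * f (g x)) \<partial>lborel)"
proof -
  have eq: "(\<lambda>x. \<bar>g' x\<bar> * f (g x)) absolutely_integrable_on S \<and> integral S (\<lambda>x. \<bar>g' x\<bar> * f (g x)) = b
     \<longleftrightarrow> f absolutely_integrable_on (g ` S) \<and> integral (g ` S) f = b" for b
    using S der inj
    by (intro has_absolute_integral_change_of_variables_1') (auto intro: has_field_derivative_at_within)
  have fin: "(\<integral>\<^sup>+y\<in>T. ennreal (h y) \<partial>lborel) = ennreal (integral T h)"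
    if "T \<in> sets borel" "h \<in> borel_measurable borel" "\<And>x. 0 \<le> h x" "h absolutely_integrable_on T" for T and h :: "real \<Rightarrow> real"
  proof -
    have "(\<integral>\<^sup>+y\<in>T. ennreal (h y) \<partial>lebesgue) = ennreal (LINT y:T|lebesgue. h y)"
      using that unfolding set_lebesgue_integral_def set_integrable_def
      by (subst nn_integral_eq_integral[symmetric]) (auto intro!: nn_integral_cong simp: indicator_def)
    with that show ?thesis
      by (simp add: nn_integral_completion set_lebesgue_integral_eq_integral)
  qed
  have inf: "(\<integral>\<^sup>+y\<in>T. ennreal (h y) \<partial>lborel) = \<infinity>"
    if "T \<in> sets borel" "h \<in> borel_measurable borel" "\<And>x. 0 \<le> h x" "\<not> h absolutely_integrable_on T" for T and h :: "real \<Rightarrow> real"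
  proof (rule ccontr)
    assume "(\<integral>\<^sup>+y\<in>T. ennreal (h y) \<partial>lborel) \<noteq> \<infinity>"
    then have "(\<integral>\<^sup>+y. ennreal (norm (indicator T y *\<^sub>R h y)) \<partial>lborel) < \<infinity>"
      using that(3) by (subst (asm) nn_integral_cong[where v="\<lambda>y. ennreal (norm (indicator T y *\<^sub>R h y))"])
        (auto simp: indicator_def less_top)
    then have "integrable lborel (\<lambda>y. indicator T y *\<^sub>R h y)"
      using that by (intro integrableI_bounded) auto
    then have "h absolutely_integrable_on T"
      unfolding set_integrable_def using that by (subst integrable_completion) auto
    with that show False by simp
  qed
  show ?thesis
  proof (cases "f absolutely_integrable_on (g ` S)")
    case True
    with eq[of "integral (g ` S) f"] show ?thesis
      using S nn by (subst (1 2) fin) auto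
  next
    case False
    with eq have "\<not> (\<lambda>x. \<bar>g' x\<bar> * f (g x)) absolutely_integrable_on S" by blast
    with False show ?thesis
      using S nn by (subst (1 2) inf) auto
  qed
qed

text \<open>Substitute \<open>y = x tan \<theta>\<close> for fixed \<open>x\<close>, swap the integrals, then \<open>x = r cos \<theta>\<close> for fixed \<open>\<theta>\<close>:
  only one-dimensional changes of variables are needed.\<close>

lemma polar_right_half_plane:
  fixes h :: "real \<times> real \<Rightarrow> real"
  assumes h [measurable]: "h \<in> borel_measurable borel" and nn: "\<And>p. 0 \<le> h p"
  shows "(\<integral>\<^sup>+x\<in>{0<..}. (\<integral>\<^sup>+y. ennreal (h (x, y)) \<partial>lborel) \<partial>lborel) =
    (\<integral>\<^sup>+\<theta>\<in>{- (pi/2)<..<pi/2}. (\<integral>\<^sup>+r\<in>{0<..}. ennreal (r * h (r * cos \<theta>, r * sin \<theta>)) \<partial>lborel) \<partial>lborel)"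
proof -
  have [measurable]: "h \<in> borel_measurable (borel \<Otimes>\<^sub>M borel)"
    by (simp add: borel_prod)
  let ?I = "{- (pi/2)<..<pi/2}"
  \<comment> \<open>The factor \<open>x / (cos \<theta>)\<^sup>2\<close> is the derivative of
    \<open>x * tan \<theta>\<close> in \<open>\<theta>\<close>.\<close>
  let ?J = "\<lambda>\<theta> x. (x / (cos \<theta>)\<^sup>2) * h (x, x * tan \<theta>)"
  have tan_m[measurable]: "tan \<in> borel_measurable (borel :: real measure)"
    unfolding tan_def[abs_def] by measurable
  have inner: "(\<integral>\<^sup>+y. ennreal (h (x, y)) \<partial>lborel) = (\<integral>\<^sup>+\<theta>\<in>?I. ennreal (?J \<theta> x) \<partial>lborel)" if x: "0 < x" for x
  proof -
    have img: "(\<lambda>\<theta>. x * tan \<theta>) ` ?I = UNIV"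
    proof -
      have "y \<in> (\<lambda>\<theta>. x * tan \<theta>) ` ?I" for y
      proof (rule image_eqI)
        show "y = x * tan (arctan (y / x))" using x by (simp add: tan_arctan)
        show "arctan (y / x) \<in> ?I" using arctan_lbound arctan_ubound by auto
      qed
      then show ?thesis by blast
    qed
    have "inj_on (\<lambda>\<theta>. x * tan \<theta>) ?I"
    proof (rule inj_onI)
      fix a b assume ab: "a \<in> ?I" "b \<in> ?I" and "x * tan a = x * tan b"
      then have "tan a = tan b" using x by simp
      then have "arctan (tan a) = arctan (tan b)" by simp
      with ab show "a = b" by (simp add: arctan_tan)
    qed
    moreover have "((\<lambda>\<theta>. x * tan \<theta>) has_field_derivative x / (cos \<theta>)\<^sup>2) (at \<theta>)" if "\<theta> \<in> ?I" for \<theta>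
    proof -
      have "cos \<theta> \<noteq> 0" using cos_gt_zero_pi[of \<theta>] that by auto
      then show ?thesis
        using DERIV_cmult[OF DERIV_tan, of \<theta> x] by (simp add: divide_inverse)
    qed
    ultimately have "(\<integral>\<^sup>+y\<in>(\<lambda>\<theta>. x * tan \<theta>) ` ?I. ennreal (h (x, y)) \<partial>lborel) =
      (\<integral>\<^sup>+\<theta>\<in>?I. ennreal (\<bar>x / (cos \<theta>)\<^sup>2\<bar> * h (x, x * tan \<theta>)) \<partial>lborel)"
      by (intro nn_integral_substitution_inj) (use img nn in auto)
    with img x show ?thesis by simp
  qed
  have "(\<integral>\<^sup>+x\<in>{0<..}. (\<integral>\<^sup>+y. ennreal (h (x, y)) \<partial>lborel) \<partial>lborel) =
    (\<integral>\<^sup>+x. (\<integral>\<^sup>+\<theta>. ennreal (?J \<theta> x) * indicator ?I \<theta> * indicator {0<..} x \<partial>lborel) \<partial>lborel)"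
    by (intro nn_integral_cong) (auto simp: inner nn_integral_multc indicator_def)
  also have "\<dots> = (\<integral>\<^sup>+\<theta>. (\<integral>\<^sup>+x. ennreal (?J \<theta> x) * indicator ?I \<theta> * indicator {0<..} x \<partial>lborel) \<partial>lborel)"
    by (rule lborel_pair.Fubini') measurable
  also have "\<dots> = (\<integral>\<^sup>+\<theta>\<in>?I. (\<integral>\<^sup>+x\<in>{0<..}. ennreal (?J \<theta> x) \<partial>lborel) \<partial>lborel)"
    by (intro nn_integral_cong) (auto simp: nn_integral_multc indicator_def)
  also have "\<dots> = (\<integral>\<^sup>+\<theta>\<in>?I. (\<integral>\<^sup>+r\<in>{0<..}. ennreal (r * h (r * cos \<theta>, r * sin \<theta>)) \<partial>lborel) \<partial>lborel)"
  proof (intro nn_integral_cong)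
    fix \<theta> :: real
    show "(\<integral>\<^sup>+x\<in>{0<..}. ennreal (?J \<theta> x) \<partial>lborel) * indicator ?I \<theta> =
      (\<integral>\<^sup>+r\<in>{0<..}. ennreal (r * h (r * cos \<theta>, r * sin \<theta>)) \<partial>lborel) * indicator ?I \<theta>"
    proof (cases "\<theta> \<in> ?I")
      case True
      then have c: "0 < cos \<theta>" using cos_gt_zero_pi[of \<theta>] by auto
      have "(\<integral>\<^sup>+x. ennreal (?J \<theta> x) * indicator {0<..} x \<partial>lborel) =
        ennreal (cos \<theta>) * (\<integral>\<^sup>+r. ennreal (?J \<theta> (cos \<theta> * r)) * indicator {0<..} (cos \<theta> * r) \<partial>lborel)"
        using nn_integral_real_affine[of "\<lambda>x. ennreal (?J \<theta> x) * indicator {0<..} x" "cos \<theta>" 0] c by simp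
      also have "\<dots> = (\<integral>\<^sup>+r. ennreal (cos \<theta>) * (ennreal (?J \<theta> (cos \<theta> * r)) * indicator {0<..} (cos \<theta> * r)) \<partial>lborel)"
        by (rule nn_integral_cmult[symmetric]) measurable
      also have "\<dots> = (\<integral>\<^sup>+r\<in>{0<..}. ennreal (r * h (r * cos \<theta>, r * sin \<theta>)) \<partial>lborel)"
      proof (intro nn_integral_cong)
        fix r :: real
        \<comment> \<open>The Jacobian \<open>cos \<theta>\<close> of the second substitution
          combines with \<open>cos \<theta> * r / (cos \<theta>)\<^sup>2\<close> to the polar factor
          \<open>r\<close>.\<close>
        have "cos \<theta> * ?J \<theta> (cos \<theta> * r) = r * h (r * cos \<theta>, r * sin \<theta>)"
          using c by (simp add: tan_def power2_eq_square mult.commute)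
        then show "ennreal (cos \<theta>) * (ennreal (?J \<theta> (cos \<theta> * r)) * indicator {0<..} (cos \<theta> * r)) =
          ennreal (r * h (r * cos \<theta>, r * sin \<theta>)) * indicator {0<..} r"
          using c by (auto simp: indicator_def zero_less_mult_iff simp flip: ennreal_mult')
      qed
      finally show ?thesis by simp
    qed simp
  qed
  finally show ?thesis .
qed

text \<open>Cut the plane along the vertical axis. The left half is the point reflection of the
  right half, so the two halves supply the angles between \<open>- (pi/2)\<close> and
  \<open>3*pi/2\<close>, which periodicity rearranges into one period starting at
  \<open>0\<close>.\<close>

lemma polar_coordinates:
  fixes h :: "real \<times> real \<Rightarrow> real"
  assumes h [measurable]: "h \<in> borel_measurable borel" and nn: "\<And>p. 0 \<le> h p"
  shows "(\<integral>\<^sup>+\<theta>\<in>{0..<2*pi}. (\<integral>\<^sup>+r\<in>{0<..}. ennreal (r * h (r * cos \<theta>, r * sin \<theta>)) \<partial>lborel) \<partial>lborel)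
     = (\<integral>\<^sup>+p. ennreal (h p) \<partial>lborel)"
proof -
  have hm [measurable]: "h \<in> borel_measurable (borel \<Otimes>\<^sub>M borel)"
    by (simp add: borel_prod)
  define R where "R \<theta> = (\<integral>\<^sup>+r\<in>{0<..}. ennreal (r * h (r * cos \<theta>, r * sin \<theta>)) \<partial>lborel)" for \<theta>
  have Rm [measurable]: "R \<in> borel_measurable borel" unfolding R_def by measurable
  have Rper: "R (\<theta> + 2 * pi) = R \<theta>" for \<theta> by (simp add: R_def)
  have AE0: "AE x in lborel. x \<noteq> (c::real)" for c by (rule AE_lborel_singleton)
  have h': "(\<lambda>p. h (- p)) \<in> borel_measurable borel" by measurable
  have "(\<integral>\<^sup>+p. ennreal (h p) \<partial>lborel) = (\<integral>\<^sup>+x. \<integral>\<^sup>+y. ennreal (h (x, y)) \<partial>lborel \<partial>lborel)"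
    unfolding lborel_prod[symmetric] by (rule lborel.nn_integral_fst[symmetric]) simp
  also have "\<dots> = (\<integral>\<^sup>+x. (\<integral>\<^sup>+y. ennreal (h (x, y)) \<partial>lborel) * indicator {0<..} x
      + (\<integral>\<^sup>+y. ennreal (h (x, y)) \<partial>lborel) * indicator {..<0} x \<partial>lborel)"
    by (rule nn_integral_cong_AE) (use AE0[of 0] in eventually_elim, auto simp: indicator_def)
  also have "\<dots> = (\<integral>\<^sup>+x\<in>{0<..}. (\<integral>\<^sup>+y. ennreal (h (x, y)) \<partial>lborel) \<partial>lborel)
      + (\<integral>\<^sup>+x\<in>{..<0}. (\<integral>\<^sup>+y. ennreal (h (x, y)) \<partial>lborel) \<partial>lborel)"
    by (rule nn_integral_add) measurable
  also have "(\<integral>\<^sup>+x\<in>{..<0}. (\<integral>\<^sup>+y. ennreal (h (x, y)) \<partial>lborel) \<partial>lborel)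
     = (\<integral>\<^sup>+x\<in>{0<..}. (\<integral>\<^sup>+y. ennreal (h (- (x, y))) \<partial>lborel) \<partial>lborel)"
  proof -
    have "(\<integral>\<^sup>+y. ennreal (h (- (x, y))) \<partial>lborel) = (\<integral>\<^sup>+y. ennreal (h (- x, y)) \<partial>lborel)" for x
      using nn_integral_minus[of "\<lambda>y. ennreal (h (- x, y))"] by simp
    then show ?thesis
      using nn_integral_minus[of "\<lambda>x. (\<integral>\<^sup>+y. ennreal (h (x, y)) \<partial>lborel) * indicator {..<0} x"]
      by (simp add: indicator_def)
  qed
  \<comment> \<open>Adding \<open>pi\<close> to the angle negates cosine and sine, so reflecting
    \<open>h\<close> through the origin advances the argument of \<open>R\<close> by
    \<open>pi\<close>.\<close>
  also have "\<dots> = (\<integral>\<^sup>+\<theta>\<in>{- (pi/2)<..<pi/2}. R (\<theta> + pi) \<partial>lborel)"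
    by (subst polar_right_half_plane[OF h' nn]) (simp add: R_def)
  also have "\<dots> = (\<integral>\<^sup>+\<theta>\<in>{pi/2<..<3*pi/2}. R \<theta> \<partial>lborel)"
    by (subst nn_integral_shift[of "\<lambda>\<theta>. R \<theta> * indicator {pi/2<..<3*pi/2} \<theta>" pi, symmetric])
       (auto intro!: nn_integral_cong simp: indicator_def)
  also have "(\<integral>\<^sup>+x\<in>{0<..}. (\<integral>\<^sup>+y. ennreal (h (x, y)) \<partial>lborel) \<partial>lborel) = (\<integral>\<^sup>+\<theta>\<in>{- (pi/2)<..<pi/2}. R \<theta> \<partial>lborel)"
    unfolding R_def by (rule polar_right_half_plane[OF h nn])
  also have "\<dots> = (\<integral>\<^sup>+\<theta>. R \<theta> * indicator {- (pi/2)<..<0} \<theta> + R \<theta> * indicator {0..<pi/2} \<theta> \<partial>lborel)"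
    by (intro nn_integral_cong) (auto simp: indicator_def)
  also have "\<dots> = (\<integral>\<^sup>+\<theta>\<in>{- (pi/2)<..<0}. R \<theta> \<partial>lborel) + (\<integral>\<^sup>+\<theta>\<in>{0..<pi/2}. R \<theta> \<partial>lborel)"
    by (rule nn_integral_add) measurable
  \<comment> \<open>The negative angles move up by a full period and fill the end of the interval
    from \<open>0\<close> to \<open>2*pi\<close>.\<close>
  also have "(\<integral>\<^sup>+\<theta>\<in>{- (pi/2)<..<0}. R \<theta> \<partial>lborel) = (\<integral>\<^sup>+\<theta>\<in>{3*pi/2<..<2*pi}. R \<theta> \<partial>lborel)"
    by (subst nn_integral_shift[of "\<lambda>\<theta>. R \<theta> * indicator {3*pi/2<..<2*pi} \<theta>" "2*pi", symmetric])
       (auto intro!: nn_integral_cong simp: indicator_def Rper)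
  also have "(\<integral>\<^sup>+\<theta>\<in>{3*pi/2<..<2*pi}. R \<theta> \<partial>lborel) + (\<integral>\<^sup>+\<theta>\<in>{0..<pi/2}. R \<theta> \<partial>lborel) + (\<integral>\<^sup>+\<theta>\<in>{pi/2<..<3*pi/2}. R \<theta> \<partial>lborel)
     = (\<integral>\<^sup>+\<theta>. R \<theta> * indicator {3*pi/2<..<2*pi} \<theta> + R \<theta> * indicator {0..<pi/2} \<theta> + R \<theta> * indicator {pi/2<..<3*pi/2} \<theta> \<partial>lborel)"
    by (subst nn_integral_add, simp, simp, subst nn_integral_add) simp_all
  also have "\<dots> = (\<integral>\<^sup>+\<theta>\<in>{0..<2*pi}. R \<theta> \<partial>lborel)"
  proof (rule nn_integral_cong_AE)
    \<comment> \<open>The three intervals miss only the angles of the vertical axis,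
      \<open>pi/2\<close> and \<open>3*pi/2\<close>.\<close>
    show "AE \<theta> in lborel. R \<theta> * indicator {3*pi/2<..<2*pi} \<theta> + R \<theta> * indicator {0..<pi/2} \<theta> + R \<theta> * indicator {pi/2<..<3*pi/2} \<theta>
        = R \<theta> * indicator {0..<2*pi} \<theta>"
      using AE0[of "pi/2"] AE0[of "3*pi/2"]
      by eventually_elim (use pi_gt_zero in \<open>auto simp: indicator_def\<close>)
  qed
  finally show ?thesis by (simp add: R_def)
qed

subsection \<open>The Bergman norm on a ray\<close>

lemma nn_integral_erlang_density_eq_1:
  assumes "0 < l"
  shows "(\<integral>\<^sup>+x. ennreal (erlang_density k l x) \<partial>lborel) = 1"
  using nn_integral_erlang_ith_moment[OF assms, of k 0] by simp

lemma nn_integral_exp_half_line: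
  assumes "0 < c"
  shows "(\<integral>\<^sup>+y\<in>{0<..}. ennreal (exp (- c * y)) \<partial>lborel) = ennreal (1 / c)"
proof -
  \<comment> \<open>At \<open>y = 0\<close> the left integrand is \<open>0\<close> and the right one
    is \<open>1\<close>, so the equality is only almost everywhere.\<close>
  have "(\<integral>\<^sup>+y\<in>{0<..}. ennreal (exp (- c * y)) \<partial>lborel) = (\<integral>\<^sup>+y. ennreal (1 / c) * ennreal (erlang_density 0 c y) \<partial>lborel)"
    by (rule nn_integral_cong_AE, use AE_lborel_singleton[of "0::real"] in eventually_elim)
       (use assms in \<open>auto simp: erlang_density_def indicator_def simp flip: ennreal_mult'\<close>)
  also have "\<dots> = ennreal (1 / c)"
    by (simp add: nn_integral_cmult nn_integral_erlang_density_eq_1[OF assms])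
  finally show ?thesis .
qed

text \<open>Up to the factor \<open>1 / c\<^sup>2\<close> this is the Erlang density with index
  \<open>1\<close>. It is the majorant on a ray, where the transform of \<open>f\<close> is merely
  known to be bounded.\<close>

lemma integrable_erlang_half_line:
  assumes c: "0 < c"
  shows "integrable lborel (\<lambda>r. indicator {0<..} r * (r * exp (- c * r)) :: real)"
proof (rule integrableI_bounded)
  have "(\<integral>\<^sup>+r. ennreal (norm (indicator {0<..} r * (r * exp (- c * r)) :: real)) \<partial>lborel)
     = (\<integral>\<^sup>+r. ennreal (1 / c\<^sup>2) * ennreal (erlang_density 1 c r) \<partial>lborel)"
    by (intro nn_integral_cong)
       (use assms in \<open>auto simp: erlang_density_def indicator_def power2_eq_square simp flip: ennreal_mult'\<close>)
  also have "\<dots> < \<infinity>"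
    by (simp add: nn_integral_cmult nn_integral_erlang_density_eq_1[OF c])
  finally show "(\<integral>\<^sup>+r. ennreal (norm (indicator {0<..} r * (r * exp (- c * r)) :: real)) \<partial>lborel) < \<infinity>" .
qed simp

lemma norm_fourier_le:
  fixes f :: "'a::euclidean_space \<Rightarrow> complex"
  shows "norm (fourier f \<xi>) \<le> (LINT x|lborel. norm (f x))"
proof -
  have "norm (fourier f \<xi>) \<le> (LINT x|lborel. norm (f x * exp (- 2 * \<i> * complex_of_real pi * complex_of_real (x \<bullet> \<xi>))))"
    unfolding fourier_def by (rule integral_norm_bound)
  also have "\<dots> = (LINT x|lborel. norm (f x))"
    by (simp add: norm_mult norm_exp_eq_Re)
  finally show ?thesis .
qed

text \<open>Tonelli and Plancherel above are stated for Borel functions and \<open>lborel\<close>.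
  Real and imaginary parts each agree almost everywhere with a Borel function, which allows passing
  to that setting.\<close>

lemma borel_representative:
  fixes f :: "real \<times> real \<Rightarrow> complex"
  assumes f: "integrable lebesgue f"
  obtains f' where "integrable lborel f'" "AE x in lebesgue. f x = f' x"
proof -
  have m: "f \<in> borel_measurable lebesgue" using f by (rule borel_measurable_integrable)
  then have "(\<lambda>x. Re (f x)) \<in> borel_measurable lebesgue" "(\<lambda>x. Im (f x)) \<in> borel_measurable lebesgue"
    by measurable
  from this[THEN completion_ex_borel_measurable_real] obtain u v
    where [measurable]: "u \<in> borel_measurable lborel" "v \<in> borel_measurable lborel"
      and uv: "AE x in lborel. Re (f x) = u x" "AE x in lborel. Im (f x) = v x" by blast
  define f' where "f' x = Complex (u x) (v x)" for x
  have f'_alt: "f' = (\<lambda>x. complex_of_real (u x) + \<i> * complex_of_real (v x))"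
    by (simp add: f'_def fun_eq_iff complex_eq_iff)
  have [measurable]: "f' \<in> borel_measurable lborel" unfolding f'_alt by measurable
  have "AE x in lborel. f x = f' x"
    using uv by eventually_elim (simp add: f'_def complex_eq_iff)
  then have ae: "AE x in lebesgue. f x = f' x" by (rule AE_completion)
  have "integrable lebesgue f'"
    using f ae by (subst integrable_cong_AE[of f' _ f]) (auto simp: m measurable_completion)
  then have "integrable lborel f'" by (simp add: integrable_completion)
  with ae that show ?thesis by blast
qed

text \<open>For \<open>y > 0\<close> the decay \<open>exp (- (2 * pi * y) * r)\<close> makes the
  damped profile \<open>g\<close> integrable although \<open>\<phi>\<close> is only bounded, so
  \<open>plancherel_real\<close> applies. Squaring doubles the decay rate and squares the weight
  \<open>r\<close>.\<close>

lemma nn_integral_angular_slice: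
  fixes \<phi> :: "real \<Rightarrow> complex"
  assumes [measurable]: "\<phi> \<in> borel_measurable borel" and bound: "\<And>r. norm (\<phi> r) \<le> M" and y: "0 < y"
  shows "(\<integral>\<^sup>+t. ennreal ((cmod (LINT r:{0<..}|lebesgue. exp (2 * \<i> * complex_of_real pi * complex_of_real r * Complex t y)
        * \<phi> r * complex_of_real r))\<^sup>2) \<partial>lborel)
    = (\<integral>\<^sup>+r\<in>{0<..}. ennreal (r\<^sup>2 * (norm (\<phi> r))\<^sup>2) * ennreal (exp (- (4 * pi * r) * y)) \<partial>lborel)"
proof -
  define g where "g r = complex_of_real (indicator {0<..} r * (r * exp (- (2 * pi * y) * r))) * \<phi> r" for r
  have [measurable]: "g \<in> borel_measurable borel" unfolding g_def by measurable
  have "integrable lborel g"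
  proof (rule Bochner_Integration.integrable_bound)
    show "integrable lborel (\<lambda>r. M * (indicator {0<..} r * (r * exp (- (2 * pi * y) * r))))"
      using integrable_erlang_half_line[of "2 * pi * y"] y by simp
    show "AE r in lborel. norm (g r) \<le> norm (M * (indicator {0<..} r * (r * exp (- (2 * pi * y) * r))))"
    proof (rule AE_I2)
      fix r :: real
      have "norm (g r) = norm (\<phi> r) * \<bar>indicator {0<..} r * (r * exp (- (2 * pi * y) * r))\<bar>"
        unfolding g_def norm_mult norm_of_real by (rule mult.commute)
      also have "\<dots> \<le> \<bar>M\<bar> * \<bar>indicator {0<..} r * (r * exp (- (2 * pi * y) * r))\<bar>"
        using bound[of r] by (intro mult_right_mono) auto
      finally show "norm (g r) \<le> norm (M * (indicator {0<..} r * (r * exp (- (2 * pi * y) * r))))"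
        by (simp only: real_norm_def abs_mult)
    qed
  qed measurable
  note pl = plancherel_real[OF this]
  \<comment> \<open>The exponent carries \<open>+ r * t\<close>, whereas \<open>fourier\<close> uses
    the opposite sign; hence the evaluation at \<open>- t\<close>.\<close>
  have slice: "(LINT r:{0<..}|lebesgue. exp (2 * \<i> * complex_of_real pi * complex_of_real r * Complex t y)
        * \<phi> r * complex_of_real r) = fourier g (- t)" for t
  proof -
    have "exp (2 * \<i> * complex_of_real pi * complex_of_real r * Complex t y) =
       complex_of_real (exp (- (2 * pi * y) * r)) * exp (- 2 * \<i> * complex_of_real pi * complex_of_real (r * - t))" for r
      by (simp add: Complex_eq algebra_simps flip: exp_of_real exp_add)
    then have "(\<lambda>r. indicator {0<..} r *\<^sub>R (exp (2 * \<i> * complex_of_real pi * complex_of_real r * Complex t y) * \<phi> r * complex_of_real r))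
      = (\<lambda>r. g r * exp (- 2 * \<i> * complex_of_real pi * complex_of_real (r * - t)))"
      by (auto simp: g_def indicator_def fun_eq_iff)
    then show ?thesis
      unfolding fourier_def set_lebesgue_integral_def by (simp add: integral_completion)
  qed
  have "(\<integral>\<^sup>+t. ennreal ((cmod (fourier g (- t)))\<^sup>2) \<partial>lborel) = (\<integral>\<^sup>+r. ennreal ((cmod (g r))\<^sup>2) \<partial>lborel)"
    using nn_integral_minus[of "\<lambda>t. ennreal ((cmod (fourier g t))\<^sup>2)"] pl by simp
  also have "\<dots> = (\<integral>\<^sup>+r\<in>{0<..}. ennreal (r\<^sup>2 * (norm (\<phi> r))\<^sup>2) * ennreal (exp (- (4 * pi * r) * y)) \<partial>lborel)"
  proof (intro nn_integral_cong)
    fix r :: real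
    have "(exp (- (2 * pi * y) * r))\<^sup>2 = exp (- (4 * pi * r) * y)"
      by (simp add: power2_eq_square algebra_simps flip: exp_add)
    then show "ennreal ((cmod (g r))\<^sup>2) = ennreal (r\<^sup>2 * (norm (\<phi> r))\<^sup>2) * ennreal (exp (- (4 * pi * r) * y)) * indicator {0<..} r"
      by (auto simp: g_def norm_mult power_mult_distrib indicator_def mult_ac simp flip: ennreal_mult')
  qed
  finally show ?thesis unfolding slice .
qed

section \<open>Assembly of the slices, polar coordinates and Plancherel in the plane\<close>

theorem mainTheorem2:
  fixes f :: "real \<times> real \<Rightarrow> complex"
  assumes "integrable lebesgue f"
  shows "ennreal (4 * pi) *
           (\<integral>\<^sup>+\<theta>\<in>{0..<2 * pi}. bergman_norm_sq (angular_transform f \<theta>) \<partial>lebesgue) =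
         L2_norm_sq f"
proof -
  obtain f' where f': "integrable lborel f'" and ae: "AE x in lebesgue. f x = f' x"
    using borel_representative[OF assms] by blast
  have f'm [measurable]: "f' \<in> borel_measurable borel"
    using borel_measurable_integrable[OF f'] by simp
  have fm: "f \<in> borel_measurable lebesgue" using assms by (rule borel_measurable_integrable)
  \<comment> \<open>Integrals ignore null sets, so changing \<open>f\<close> to \<open>f'\<close>
    leaves the transform unchanged at every \<open>\<xi>\<close>, including along each single
    ray.\<close>
  have transform_eq: "fourier_transform f \<xi> = fourier f' \<xi>" for \<xi>
  proof -
    let ?e = "\<lambda>x. exp (- 2 * \<i> * complex_of_real pi * complex_of_real (x \<bullet> \<xi>))"
    have "?e \<in> borel_measurable borel" by measurable
    then have e: "?e \<in> borel_measurable lebesgue" by (intro measurable_completion) simp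
    have "fourier_transform f \<xi> = (LINT x|lebesgue. f' x * ?e x)"
      unfolding fourier_transform_def
    proof (rule integral_cong_AE)
      show "(\<lambda>x. f x * ?e x) \<in> borel_measurable lebesgue"
        by (intro borel_measurable_times fm e)
      show "(\<lambda>x. f' x * ?e x) \<in> borel_measurable lebesgue"
        using f'm by (intro borel_measurable_times measurable_completion e) simp
      show "AE x in lebesgue. f x * ?e x = f' x * ?e x"
        using ae by eventually_elim simp
    qed
    also have "\<dots> = fourier f' \<xi>"
      unfolding fourier_def by (rule integral_completion) measurable
    finally show ?thesis .
  qed
  define h where "h p = (norm (fourier f' p))\<^sup>2" for p
  have hm [measurable]: "h \<in> borel_measurable borel" unfolding h_def by measurable
  have hm2 [measurable]: "h \<in> borel_measurable (borel \<Otimes>\<^sub>M borel)"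
    using hm by (simp add: borel_prod)
  have bergman: "bergman_norm_sq (angular_transform f \<theta>) =
    ennreal (1 / (4 * pi)) * (\<integral>\<^sup>+r\<in>{0<..}. ennreal (r * h (r * cos \<theta>, r * sin \<theta>)) \<partial>lborel)" for \<theta>
  proof -
    let ?\<phi> = "\<lambda>r. fourier f' (r * cos \<theta>, r * sin \<theta>)"
    let ?H = "\<lambda>r. h (r * cos \<theta>, r * sin \<theta>)"
    have \<phi>m: "?\<phi> \<in> borel_measurable borel"
      by (rule measurable_compose[OF _ borel_measurable_fourier[OF f'm]]) (simp flip: borel_prod)
    have "bergman_norm_sq (angular_transform f \<theta>) =
      (\<integral>\<^sup>+y\<in>{0<..}. (\<integral>\<^sup>+t. ennreal ((cmod (angular_transform f \<theta> (Complex t y)))\<^sup>2) \<partial>lborel) \<partial>lborel)"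
      by (simp add: bergman_norm_sq_def nn_integral_completion)
    also have "\<dots> = (\<integral>\<^sup>+y\<in>{0<..}. (\<integral>\<^sup>+r\<in>{0<..}. ennreal (r\<^sup>2 * ?H r) * ennreal (exp (- (4 * pi * r) * y)) \<partial>lborel) \<partial>lborel)"
    proof (intro nn_integral_cong)
      fix y :: real
      show "(\<integral>\<^sup>+t. ennreal ((cmod (angular_transform f \<theta> (Complex t y)))\<^sup>2) \<partial>lborel) * indicator {0<..} y =
        (\<integral>\<^sup>+r\<in>{0<..}. ennreal (r\<^sup>2 * ?H r) * ennreal (exp (- (4 * pi * r) * y)) \<partial>lborel) * indicator {0<..} y"
      proof (cases "0 < y")
        case True
        then show ?thesis
          using nn_integral_angular_slice[OF \<phi>m norm_fourier_le True]
          by (simp add: angular_transform_def transform_eq h_def)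
      qed simp
    qed
    also have "\<dots> = (\<integral>\<^sup>+y. (\<integral>\<^sup>+r. ennreal (r\<^sup>2 * ?H r) * ennreal (exp (- (4 * pi * r) * y)) * indicator {0<..} r * indicator {0<..} y \<partial>lborel) \<partial>lborel)"
      by (intro nn_integral_cong nn_integral_multc[symmetric]) measurable
    also have "\<dots> = (\<integral>\<^sup>+r. (\<integral>\<^sup>+y. ennreal (r\<^sup>2 * ?H r) * ennreal (exp (- (4 * pi * r) * y)) * indicator {0<..} r * indicator {0<..} y \<partial>lborel) \<partial>lborel)"
      by (rule lborel_pair.Fubini') measurable
    also have "\<dots> = (\<integral>\<^sup>+r. ennreal (1 / (4 * pi)) * (ennreal (r * ?H r) * indicator {0<..} r) \<partial>lborel)"
    proof (intro nn_integral_cong)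
      fix r :: real
      show "(\<integral>\<^sup>+y. ennreal (r\<^sup>2 * ?H r) * ennreal (exp (- (4 * pi * r) * y)) * indicator {0<..} r * indicator {0<..} y \<partial>lborel)
        = ennreal (1 / (4 * pi)) * (ennreal (r * ?H r) * indicator {0<..} r)"
      proof (cases "0 < r")
        case True
        have "(\<integral>\<^sup>+y. ennreal (r\<^sup>2 * ?H r) * ennreal (exp (- (4 * pi * r) * y)) * indicator {0<..} r * indicator {0<..} y \<partial>lborel)
          = (\<integral>\<^sup>+y. ennreal (r\<^sup>2 * ?H r) * (ennreal (exp (- (4 * pi * r) * y)) * indicator {0<..} y) \<partial>lborel)"
          using True by (simp add: mult.assoc)
        also have "\<dots> = ennreal (r\<^sup>2 * ?H r) * (\<integral>\<^sup>+y\<in>{0<..}. ennreal (exp (- (4 * pi * r) * y)) \<partial>lborel)"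
          by (rule nn_integral_cmult) measurable
        \<comment> \<open>The height integral contributes \<open>1 / (4 * pi * r)\<close>, which
          cancels one of the two factors \<open>r\<close> and leaves the polar weight.\<close>
        also have "\<dots> = ennreal (r\<^sup>2 * ?H r) * ennreal (1 / (4 * pi * r))"
          using True by (subst nn_integral_exp_half_line) simp_all
        also have "\<dots> = ennreal (1 / (4 * pi)) * ennreal (r * ?H r)"
          using True by (simp add: h_def power2_eq_square[of r] flip: ennreal_mult)
        finally show ?thesis using True by simp
      qed simp
    qed
    also have "\<dots> = ennreal (1 / (4 * pi)) * (\<integral>\<^sup>+r\<in>{0<..}. ennreal (r * ?H r) \<partial>lborel)"
      by (rule nn_integral_cmult) measurable
    finally show ?thesis .
  qed
  have "(\<integral>\<^sup>+\<theta>\<in>{0..<2 * pi}. bergman_norm_sq (angular_transform f \<theta>) \<partial>lebesgue) =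
    (\<integral>\<^sup>+\<theta>. ennreal (1 / (4 * pi)) * ((\<integral>\<^sup>+r\<in>{0<..}. ennreal (r * h (r * cos \<theta>, r * sin \<theta>)) \<partial>lborel) * indicator {0..<2 * pi} \<theta>) \<partial>lborel)"
    by (simp add: nn_integral_completion bergman mult.assoc)
  also have "\<dots> = ennreal (1 / (4 * pi)) * (\<integral>\<^sup>+\<theta>\<in>{0..<2 * pi}. (\<integral>\<^sup>+r\<in>{0<..}. ennreal (r * h (r * cos \<theta>, r * sin \<theta>)) \<partial>lborel) \<partial>lborel)"
    by (rule nn_integral_cmult) measurable
  also have "\<dots> = ennreal (1 / (4 * pi)) * (\<integral>\<^sup>+x. ennreal ((norm (f' x))\<^sup>2) \<partial>lborel)"
    by (subst polar_coordinates[OF hm]) (simp_all add: h_def plancherel_plane[OF f'])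
  \<comment> \<open>The squared norm also depends only on the almost everywhere class, so
    \<open>f'\<close> can be replaced by \<open>f\<close> again.\<close>
  also have "(\<integral>\<^sup>+x. ennreal ((norm (f' x))\<^sup>2) \<partial>lborel) = L2_norm_sq f"
    unfolding L2_norm_sq_def nn_integral_completion[symmetric, of lborel]
    by (rule nn_integral_cong_AE) (use ae in eventually_elim, simp)
  finally show ?thesis
    by (simp add: mult.assoc[symmetric] flip: ennreal_mult')
qed

end
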